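(* Let $X=V(f)\subset\mathbb{P}^n$ be an irreducible hypersurface of degree at least two which is not a cone, such that $\operatorname{trop}(X)\subset\mathbb{R}^n$ is smooth. Let $p\in\operatorname{trop}(X)$ be a vertex, and let $\mathcal{J}(p)$ be the collection of maximal subsets $J\subset\{0,\dots,n\}$ such that $\langle E\rangle\cap\langle J\rangle=0$ for every edge $E$ of $\operatorname{trop}(X)$ adjacent to $p$. Then the Euclidean closure of the set of all tropical tangents at $p$ is $$\bigcup_{J\in\mathcal{J}(p)}\Big(-p-\sum_{i\in J}\mathbb{R}_{\geq 0}\cdot e_i\Big).$$
   Context: $\mathbb{K}$ is an algebraically closed field of characteristic zero with nontrivial non-Archimedean valuation $\nu$ trivial on the integers; $\operatorname{trop}(x_1,\dots,x_m)=(-\nu(x_1),\dots,-\nu(x_m))$ and the tropicalization of a variety is the Euclidean closure of the image of its intersection with the torus. On $\mathbb{P}^n$ use torus coordinates $x_1/x_0,\dots,x_n/x_0$, on the dual $(\mathbb{P}^n)^*$ (points are hyperplanes $(y_0:\dots:y_n)$) torus coordinates $y_1/y_0,\dots,y_n/y_0$. Write $f=\sum_{u\in\mathcal{A}}c_ux^u$, $\mathcal{A}\subset\mathbb{Z}^{n+1}$, $c_u\ne0$; "not a cone" means $f$ involves all variables. The valuations $\nu(c_u)$ induce a regular subdivision of the Newton polytope $\operatorname{conv}\mathcal{A}$; $\operatorname{trop}(X)$ carries the dual polyhedral complex structure (vertices = $0$-cells, edges = $1$-cells, possibly unbounded), and is smooth if the subdivision is a unimodular triangulation. $e_1,\dots,e_n$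 is the standard basis of $\mathbb{R}^n$, $e_0=-e_1-\dots-e_n$; $\langle J\rangle$ is the span of $\{e_i\}_{i\in J}$, and for $S\subset\mathbb{R}^n$, $\langle S\rangle$ is the linear span of differences of elements of $S$. A point $q\in\mathbb{R}^n$ is a tropical tangent at $p\in\operatorname{trop}(X)$ if there is a smooth point $x\in X\cap(\mathbb{K}^* )^n$ with $\operatorname{trop}(x)=p$ whose tangent hyperplane, as a point of $(\mathbb{P}^n)^*$, lies in the dual torus and tropicalizes to $q$. *)

theory Defs
  imports "HOL-Analysis.Analysis" "HOL-Library.Poly_Mapping"
    "HOL-Computational_Algebra.Polynomial" "HOL-Computational_Algebra.Factorial_Ring"
begin

text \<open>Conventions. The ambient projective space is P^n with n = CARD('n);
  homogeneous coordinates are indexed by 'n option, None being x_0 and Some i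
  being x_i. The torus (K^*)^n consists of functions 'n \<Rightarrow> 'k with nonzero values,
  identified with the points (1 : z_1 : ... : z_n). R^n is real^'n.
  A homogeneous polynomial is a finitely supported map (poly_mapping)
  from exponent vectors 'n option =>0 nat to coefficients in 'k.\<close>

definition alg_closed :: "'k::field itself \<Rightarrow> bool" where
  "alg_closed _ \<longleftrightarrow> (\<forall>p :: 'k poly. degree p \<ge> 1 \<longrightarrow> (\<exists>x. poly p x = 0))"

text \<open>A nontrivial non-Archimedean valuation, trivial on the integers
  (given on nonzero elements; nu 0 = infinity is never used).\<close>
definition nonarch_valuation :: "('k::field_char_0 \<Rightarrow> real) \<Rightarrow> bool" where
  "nonarch_valuation \<nu> \<longleftrightarrow>
     (\<forall>x y. x \<noteq> 0 \<longrightarrow> y \<noteq> 0 \<longrightarrow> \<nu> (x * y) = \<nu> x + \<nu> y) \<and>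
     (\<forall>x y. x \<noteq> 0 \<longrightarrow> y \<noteq> 0 \<longrightarrow> x + y \<noteq> 0 \<longrightarrow> \<nu> (x + y) \<ge> min (\<nu> x) (\<nu> y)) \<and>
     (\<forall>m::int. m \<noteq> 0 \<longrightarrow> \<nu> (of_int m) = 0) \<and>
     (\<exists>x. x \<noteq> 0 \<and> \<nu> x \<noteq> 0)"

definition homogeneous_of_degree ::
  "(('n::finite option \<Rightarrow>\<^sub>0 nat) \<Rightarrow>\<^sub>0 'k::zero) \<Rightarrow> nat \<Rightarrow> bool" where
  "homogeneous_of_degree f d \<longleftrightarrow> (\<forall>u \<in> Poly_Mapping.keys f. (\<Sum>i\<in>UNIV. Poly_Mapping.lookup u i) = d)"

text \<open>f is not a cone: it involves all variables.\<close>
definition involves_all_vars :: "(('n::finite option \<Rightarrow>\<^sub>0 nat) \<Rightarrow>\<^sub>0 'k::zero) \<Rightarrow> bool" where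
  "involves_all_vars f \<longleftrightarrow> (\<forall>i. \<exists>u \<in> Poly_Mapping.keys f. Poly_Mapping.lookup u i \<noteq> 0)"

definition hpt :: "('n \<Rightarrow> 'k::one) \<Rightarrow> 'n option \<Rightarrow> 'k" where
  "hpt z = (\<lambda>j. case j of None \<Rightarrow> 1 | Some i \<Rightarrow> z i)"

definition peval :: "(('n::finite option \<Rightarrow>\<^sub>0 nat) \<Rightarrow>\<^sub>0 'k::comm_ring_1) \<Rightarrow> ('n option \<Rightarrow> 'k) \<Rightarrow> 'k" where
  "peval f x = (\<Sum>u\<in>Poly_Mapping.keys f. Poly_Mapping.lookup f u * (\<Prod>j\<in>UNIV. x j ^ Poly_Mapping.lookup u j))"

definition pderiv_eval ::
  "(('n::finite option \<Rightarrow>\<^sub>0 nat) \<Rightarrow>\<^sub>0 'k::comm_ring_1) \<Rightarrow> 'n option \<Rightarrow> ('n option \<Rightarrow> 'k) \<Rightarrow> 'k" where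
  "pderiv_eval f i x = (\<Sum>u\<in>Poly_Mapping.keys f. Poly_Mapping.lookup f u * of_nat (Poly_Mapping.lookup u i) *
      (\<Prod>j\<in>UNIV. x j ^ (if j = i then Poly_Mapping.lookup u j - 1 else Poly_Mapping.lookup u j)))"

definition in_torus :: "('n \<Rightarrow> 'k::zero) \<Rightarrow> bool" where
  "in_torus z \<longleftrightarrow> (\<forall>i. z i \<noteq> 0)"

definition trop_pt :: "('k \<Rightarrow> real) \<Rightarrow> ('n::finite \<Rightarrow> 'k) \<Rightarrow> real^'n" where
  "trop_pt \<nu> z = (\<chi> i. - \<nu> (z i))"

definition trop_hyp ::
  "('k::field_char_0 \<Rightarrow> real) \<Rightarrow> (('n::finite option \<Rightarrow>\<^sub>0 nat) \<Rightarrow>\<^sub>0 'k) \<Rightarrow> (real^'n) set" where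
  "trop_hyp \<nu> f = closure {trop_pt \<nu> z | z. in_torus z \<and> peval f (hpt z) = 0}"

text \<open>q is a tropical tangent at p: there is a smooth point of X in the torus
  tropicalizing to p whose tangent hyperplane (grad f) lies in the dual torus
  and tropicalizes (in coordinates y_i/y_0) to q.\<close>
definition trop_tangent ::
  "('k::field_char_0 \<Rightarrow> real) \<Rightarrow> (('n::finite option \<Rightarrow>\<^sub>0 nat) \<Rightarrow>\<^sub>0 'k) \<Rightarrow> real^'n \<Rightarrow> real^'n \<Rightarrow> bool" where
  "trop_tangent \<nu> f p q \<longleftrightarrow>
     (\<exists>z. in_torus z \<and> peval f (hpt z) = 0 \<and>
          (\<exists>j. pderiv_eval f j (hpt z) \<noteq> 0) \<and>
          (\<forall>j. pderiv_eval f j (hpt z) \<noteq> 0) \<and>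
          trop_pt \<nu> z = p \<and>
          q = (\<chi> i. - \<nu> (pderiv_eval f (Some i) (hpt z) / pderiv_eval f None (hpt z))))"

definition proj_int :: "('n::finite option \<Rightarrow>\<^sub>0 nat) \<Rightarrow> int^'n" where
  "proj_int u = (\<chi> i. int (Poly_Mapping.lookup u (Some i)))"

definition proj_real :: "('n::finite option \<Rightarrow>\<^sub>0 nat) \<Rightarrow> real^'n" where
  "proj_real u = (\<chi> i. real (Poly_Mapping.lookup u (Some i)))"

text \<open>Monomials attaining max_u (-nu(c_u) + <u,w>) : the cell of the regular
  subdivision of the Newton polytope selected by w.\<close>
definition max_terms ::
  "('k::field_char_0 \<Rightarrow> real) \<Rightarrow> (('n::finite option \<Rightarrow>\<^sub>0 nat) \<Rightarrow>\<^sub>0 'k) \<Rightarrow> real^'n \<Rightarrow> ('n option \<Rightarrow>\<^sub>0 nat) set" where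
  "max_terms \<nu> f w = {u \<in> Poly_Mapping.keys f. \<forall>v \<in> Poly_Mapping.keys f.
       - \<nu> (Poly_Mapping.lookup f v) + proj_real v \<bullet> w \<le> - \<nu> (Poly_Mapping.lookup f u) + proj_real u \<bullet> w}"

definition unimodular_simplex :: "('n::finite option \<Rightarrow>\<^sub>0 nat) set \<Rightarrow> bool" where
  "unimodular_simplex S \<longleftrightarrow> finite S \<and> card S = CARD('n) + 1 \<and>
     (\<exists>u0 \<in> S. \<forall>v :: int^'n. \<exists>a :: ('n option \<Rightarrow>\<^sub>0 nat) \<Rightarrow> int.
         v = (\<Sum>u\<in>S. a u *s (proj_int u - proj_int u0)))"

text \<open>trop(X) smooth: the regular subdivision is a unimodular triangulation,
  i.e. every cell lies in a maximal cell that is a unimodular n-simplex.\<close>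
definition trop_smooth ::
  "('k::field_char_0 \<Rightarrow> real) \<Rightarrow> (('n::finite option \<Rightarrow>\<^sub>0 nat) \<Rightarrow>\<^sub>0 'k) \<Rightarrow> bool" where
  "trop_smooth \<nu> f \<longleftrightarrow> (\<forall>w. \<exists>w'. max_terms \<nu> f w \<subseteq> max_terms \<nu> f w' \<and>
       unimodular_simplex (max_terms \<nu> f w'))"

definition dual_cell ::
  "('k::field_char_0 \<Rightarrow> real) \<Rightarrow> (('n::finite option \<Rightarrow>\<^sub>0 nat) \<Rightarrow>\<^sub>0 'k) \<Rightarrow> ('n option \<Rightarrow>\<^sub>0 nat) set \<Rightarrow> (real^'n) set" where
  "dual_cell \<nu> f S = {w. S \<subseteq> max_terms \<nu> f w}"

text \<open>Vertices (0-cells): dual to n-dimensional cells of the subdivision.\<close>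
definition trop_vertex ::
  "('k::field_char_0 \<Rightarrow> real) \<Rightarrow> (('n::finite option \<Rightarrow>\<^sub>0 nat) \<Rightarrow>\<^sub>0 'k) \<Rightarrow> real^'n \<Rightarrow> bool" where
  "trop_vertex \<nu> f p \<longleftrightarrow> aff_dim (proj_real ` max_terms \<nu> f p) = int CARD('n)"

text \<open>Edges (1-cells): duals of (n-1)-dimensional cells of the subdivision.\<close>
definition trop_edges ::
  "('k::field_char_0 \<Rightarrow> real) \<Rightarrow> (('n::finite option \<Rightarrow>\<^sub>0 nat) \<Rightarrow>\<^sub>0 'k) \<Rightarrow> (real^'n) set set" where
  "trop_edges \<nu> f = {dual_cell \<nu> f (max_terms \<nu> f w) | w.
       aff_dim (proj_real ` max_terms \<nu> f w) = int CARD('n) - 1}"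

definition evec :: "'n::finite option \<Rightarrow> real^'n" where
  "evec j = (case j of None \<Rightarrow> - (\<Sum>i\<in>UNIV. axis i 1) | Some i \<Rightarrow> axis i 1)"

definition diff_span :: "(real^'n::finite) set \<Rightarrow> (real^'n) set" where
  "diff_span S = span {a - b | a b. a \<in> S \<and> b \<in> S}"

definition admissible_J ::
  "('k::field_char_0 \<Rightarrow> real) \<Rightarrow> (('n::finite option \<Rightarrow>\<^sub>0 nat) \<Rightarrow>\<^sub>0 'k) \<Rightarrow> real^'n \<Rightarrow> 'n option set \<Rightarrow> bool" where
  "admissible_J \<nu> f p J \<longleftrightarrow> (\<forall>E \<in> trop_edges \<nu> f. p \<in> E \<longrightarrow> diff_span E \<inter> span (evec ` J) = {0})"

definition Jset ::
  "('k::field_char_0 \<Rightarrow> real) \<Rightarrow> (('n::finite option \<Rightarrow>\<^sub>0 nat) \<Rightarrow>\<^sub>0 'k) \<Rightarrow> real^'n \<Rightarrow> 'n option set set" where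
  "Jset \<nu> f p = {J. admissible_J \<nu> f p J \<and> (\<forall>J'. J \<subset> J' \<longrightarrow> \<not> admissible_J \<nu> f p J')}"

end

(* At the vertex p the maximal terms of f form a unimodular simplex; after scaling the homogeneous
   coordinates they have valuation 0 and every other term has positive valuation. Hence the
   logarithmic derivatives F_j = x_j df/dx_j are congruent to linear forms L_j in the maximal terms,
   the tropical tangent is -p - sum_j nu(F_j) e_j, and the relation sum_j F_j = d f together with the
   invertibility of the exponent matrix controls which F_j can vanish modulo the maximal ideal.
   If D is d times the inverse exponent matrix, both this condition and the condition on the edges at
   p say that no column of D is constant off J. Conversely, for such J one prescribes integer values of the
   maximal terms with L_j = 0 exactly for j in J, and finitely many Newton steps followed by a
   one-variable root approximation give a point of X with prescribed valuations of the F_j, j in J.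
   No completeness of the field is needed, since only f = 0 has to hold exactly. *)

theory Submission
  imports Defs
begin

section \<open>Non-Archimedean valuations\<close>

text \<open>Both conditions on J come from one matrix identity. Let M be the exponent matrix of the
  maximal terms and a the vector of their values. Up to positive valuation, L = M^T a, so d a_k is
  the pairing of L with column k of \<open>D\<close>. Each a_k has valuation 0, so no column may
  annihilate L; since the L_j sum to zero, a column that is constant on the support of L would do
  so. On the polyhedral side, column k of \<open>D\<close>, read as coefficients of the e_j, is the
  direction in which all maximal terms but the k-th stay tied: an edge at p. Adding a constant to
  the column changes nothing there, since the e_j sum to zero. Maximality of J enters in the
  converse: a generic integer vector that vanishes on J has a zero set satisfying the same
  condition, so it vanishes nowhere else. The Newton steps solve with a Hessian frozen at integers.
  Its inverse has only integer denominators, which are units for the valuation, so every step gains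
  the same amount \<open>\<delta>\<close>; finitely many suffice because valuations only have to be
  matched up to a fixed precision.\<close>

locale valued =
  fixes \<nu> :: "'k::field_char_0 \<Rightarrow> real"
  assumes nonarch: "nonarch_valuation \<nu>"
begin

text \<open>The value \<open>\<nu> 0\<close> is junk, so bounds are stated with a separate clause for zero.\<close>

definition vge :: "'k \<Rightarrow> real \<Rightarrow> bool" where
  "vge x r \<longleftrightarrow> x = 0 \<or> r \<le> \<nu> x"

lemma val_mult: "x \<noteq> 0 \<Longrightarrow> y \<noteq> 0 \<Longrightarrow> \<nu> (x * y) = \<nu> x + \<nu> y"
  using nonarch by (simp add: nonarch_valuation_def)

lemma val_of_int: "m \<noteq> 0 \<Longrightarrow> \<nu> (of_int m) = 0"
  using nonarch by (simp add: nonarch_valuation_def)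

lemma val_one: "\<nu> 1 = 0"
  using val_of_int[of 1] by simp

lemma val_minus: "\<nu> (- x) = \<nu> x"
proof (cases "x = 0")
  case False
  then show ?thesis
    using val_mult[of "-1" x] val_of_int[of "-1"] by simp
qed simp

lemma val_inverse: "x \<noteq> 0 \<Longrightarrow> \<nu> (inverse x) = - \<nu> x"
  using val_mult[of x "inverse x"] by (simp add: val_one)

lemma val_divide: "x \<noteq> 0 \<Longrightarrow> y \<noteq> 0 \<Longrightarrow> \<nu> (x / y) = \<nu> x - \<nu> y"
  by (simp add: divide_inverse val_mult val_inverse)

lemma val_power: "x \<noteq> 0 \<Longrightarrow> \<nu> (x ^ n) = of_nat n * \<nu> x"
  by (induction n) (auto simp: val_one val_mult algebra_simps)

lemma val_powi: "x \<noteq> 0 \<Longrightarrow> \<nu> (x powi n) = of_int n * \<nu> x"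
  by (auto simp: power_int_def val_power val_inverse)

lemma val_prod: "finite I \<Longrightarrow> (\<And>i. i \<in> I \<Longrightarrow> x i \<noteq> 0) \<Longrightarrow> \<nu> (\<Prod>i\<in>I. x i) = (\<Sum>i\<in>I. \<nu> (x i))"
  by (induction I rule: finite_induct) (auto simp: val_one val_mult)

lemma vge_0 [simp]: "vge 0 r"
  by (simp add: vge_def)

lemma vge_mono: "vge x r \<Longrightarrow> s \<le> r \<Longrightarrow> vge x s"
  by (auto simp: vge_def)

lemma vge_add: "vge x r \<Longrightarrow> vge y r \<Longrightarrow> vge (x + y) r"
proof -
  assume "vge x r" "vge y r"
  then show ?thesis
    using nonarch unfolding nonarch_valuation_def vge_def
    by (smt (verit) add.left_neutral add.right_neutral)
qed

lemma vge_minus: "vge x r \<Longrightarrow> vge (- x) r"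
  by (auto simp: vge_def val_minus)

lemma vge_diff: "vge x r \<Longrightarrow> vge y r \<Longrightarrow> vge (x - y) r"
  using vge_add[of x r "- y"] vge_minus[of y r] by simp

lemma vge_sum: "(\<And>i. i \<in> I \<Longrightarrow> vge (x i) r) \<Longrightarrow> vge (\<Sum>i\<in>I. x i) r"
  by (induction I rule: infinite_finite_induct) (auto intro: vge_add)

lemma vge_mult: "vge x r \<Longrightarrow> vge y s \<Longrightarrow> vge (x * y) (r + s)"
  by (cases "x = 0"; cases "y = 0") (auto simp: vge_def val_mult)

lemma vge_mult_left: "vge x 0 \<Longrightarrow> vge y s \<Longrightarrow> vge (x * y) s"
  using vge_mult[of x 0 y s] by simp

lemma vge_mult_right: "vge x s \<Longrightarrow> vge y 0 \<Longrightarrow> vge (x * y) s"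
  using vge_mult[of x s y 0] by simp

lemma vge_of_int: "vge (of_int m) 0"
  by (cases "m = 0") (auto simp: vge_def val_of_int)

lemma vge_of_nat: "vge (of_nat m) 0"
  using vge_of_int[of "int m"] by simp

lemma vge_one: "vge 1 0"
  using vge_of_nat[of 1] by simp

lemma vge_divide_int: "vge x r \<Longrightarrow> m \<noteq> 0 \<Longrightarrow> vge (x / of_int m) r"
  by (cases "x = 0") (auto simp: vge_def val_divide val_of_int)

lemma val_add_small:
  assumes "x \<noteq> 0" "vge y r" "\<nu> x < r"
  shows "x + y \<noteq> 0" "\<nu> (x + y) = \<nu> x"
proof -
  have y: "y = 0 \<or> \<nu> x < \<nu> y"
    using assms by (auto simp: vge_def)
  show nz: "x + y \<noteq> 0"
    using y assms(1) val_minus[of x] by (auto simp: add_eq_0_iff)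
  have "vge (x + y) (\<nu> x)"
    using assms by (intro vge_add) (auto simp: vge_def)
  moreover have "\<not> \<nu> x < \<nu> (x + y)"
  proof
    assume less: "\<nu> x < \<nu> (x + y)"
    have "vge ((x + y) - y) (min (\<nu> (x + y)) r)"
      using assms(2) by (intro vge_diff) (auto simp: vge_def)
    then show False
      using less assms by (auto simp: vge_def)
  qed
  ultimately show "\<nu> (x + y) = \<nu> x"
    using nz by (auto simp: vge_def)
qed

lemma power_one_plus_small:
  assumes "0 \<le> r" "vge \<eta> r"
  shows "vge ((1 + \<eta>) ^ n - 1 - of_nat n * \<eta>) (2 * r)"
proof (induction n)
  case (Suc n)
  have "(1 + \<eta>) ^ Suc n - 1 - of_nat (Suc n) * \<eta> =
    (1 + \<eta>) * ((1 + \<eta>) ^ n - 1 - of_nat n * \<eta>) + of_nat n * (\<eta> * \<eta>)"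
    by (simp add: algebra_simps)
  moreover have "vge (1 + \<eta>) 0"
    using assms by (intro vge_add vge_one vge_mono[OF assms(2)])
  moreover have "vge (\<eta> * \<eta>) (2 * r)"
    using vge_mult[OF assms(2) assms(2)] by simp
  ultimately show ?case
    using Suc by (auto intro!: vge_add vge_mult_left vge_of_nat)
qed simp

lemma prod_one_plus_small:
  assumes "0 \<le> r" "finite I" "\<And>i. i \<in> I \<Longrightarrow> vge (\<eta> i) r"
  shows "vge ((\<Prod>i\<in>I. (1 + \<eta> i) ^ u i) - 1 - (\<Sum>i\<in>I. of_nat (u i) * \<eta> i)) (2 * r)"
  using assms(2,3)
proof (induction I rule: finite_induct)
  case (insert i I)
  define a s where "a = of_nat (u i) * \<eta> i" and "s = (\<Sum>i\<in>I. of_nat (u i) * \<eta> i)"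
  define B where "B = (\<Prod>i\<in>I. (1 + \<eta> i) ^ u i)"
  define A where "A = (1 + \<eta> i) ^ u i"
  have A: "vge (A - 1 - a) (2 * r)"
    unfolding A_def a_def using insert assms(1) by (intro power_one_plus_small) auto
  have B: "vge (B - 1 - s) (2 * r)"
    unfolding B_def s_def using insert by auto
  have a: "vge a r" and s: "vge s r"
    unfolding a_def s_def using insert by (auto intro!: vge_sum vge_mult_left vge_of_nat)
  have B0: "vge B 0"
    using vge_add[OF vge_add[OF vge_one vge_mono[OF s assms(1)]], of "B - 1 - s"]
      vge_mono[OF B, of 0] assms(1) by simp
  have a0: "vge (1 + a) 0"
    by (intro vge_add vge_one vge_mono[OF a assms(1)])
  have "A * B - 1 - (a + s) = a * s + (1 + a) * (B - 1 - s) + (A - 1 - a) * B"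
    by (simp add: algebra_simps)
  moreover have "vge (a * s + (1 + a) * (B - 1 - s) + (A - 1 - a) * B) (2 * r)"
    using vge_mult[OF a s] A B B0 a0
    by (intro vge_add) (auto intro: vge_mult_left vge_mult_right)
  ultimately show ?case
    using insert(1,2) by (simp add: A_def B_def a_def s_def)
qed simp

text \<open>A Hensel lemma without completeness: for a constant coefficient with a large valuation
  and a linear coefficient of valuation zero, some root is small, because the quotient of the
  linear by the constant coefficient is minus the sum of the inverses of the roots.\<close>

lemma linear_coeff_of_large_roots:
  assumes "alg_closed TYPE('k)" "coeff g 0 \<noteq> 0" "\<And>h. poly g h = 0 \<Longrightarrow> \<nu> h < N"
  shows "coeff g 1 = 0 \<or> \<nu> (coeff g 0) - N < \<nu> (coeff g 1)"
  using assms(2,3)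
proof (induction "degree g" arbitrary: g)
  case 0
  then show ?case
    by (metis coeff_eq_0 less_one)
next
  case (Suc m)
  then obtain h where h: "poly g h = 0"
    using assms(1) unfolding alg_closed_def by (metis One_nat_def Suc_le_mono le0)
  then obtain g' where g': "g = [:- h, 1:] * g'"
    by (metis poly_eq_0_iff_dvd dvd_def)
  have "g' \<noteq> 0"
    using Suc.prems g' by auto
  then have "degree g' = m"
    using Suc.hyps(2) unfolding g' by (subst (asm) degree_mult_eq) auto
  have c0: "coeff g 0 = - h * coeff g' 0" and c1: "coeff g 1 = coeff g' 0 - h * coeff g' 1"
    unfolding g' by (simp_all add: coeff_pCons)
  have nz: "h \<noteq> 0" "coeff g' 0 \<noteq> 0"
    using c0 Suc.prems(1) by auto
  have IH: "coeff g' 1 = 0 \<or> \<nu> (coeff g' 0) - N < \<nu> (coeff g' 1)"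
    using Suc.prems \<open>degree g' = m\<close> nz by (intro Suc.hyps) (auto simp: g')
  have v0: "\<nu> (coeff g 0) = \<nu> h + \<nu> (coeff g' 0)"
    using nz by (simp add: c0 val_minus val_mult)
  have "\<nu> h < N"
    using Suc.prems h by blast
  define e where "e = min (\<nu> (coeff g' 0)) (if coeff g' 1 = 0 then \<nu> (coeff g' 0) else \<nu> h + \<nu> (coeff g' 1))"
  have "vge (coeff g 1) e"
    unfolding c1 e_def using nz by (intro vge_diff) (auto simp: vge_def val_mult)
  moreover have "\<nu> (coeff g 0) - N < e"
    using IH \<open>\<nu> h < N\<close> v0 by (auto simp: e_def)
  ultimately show ?case
    by (auto simp: vge_def)
qed

text \<open>If all roots had valuation below \<open>N\<close>, the previous lemma would give the
  linear coefficient a valuation above \<open>\<nu> (coeff g 0) - N\<close>, which is nonnegative,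
  or make it zero.\<close>

lemma small_root:
  assumes "alg_closed TYPE('k)" "coeff g 1 \<noteq> 0" "\<nu> (coeff g 1) = 0" "vge (coeff g 0) N"
  obtains h where "poly g h = 0" "vge h N"
proof (cases "coeff g 0 = 0")
  case True
  then show ?thesis
    using that[of 0] by (simp add: poly_0_coeff_0)
next
  case False
  then show ?thesis
    using linear_coeff_of_large_roots[OF assms(1) False, of N] assms that
    by (force simp: vge_def)
qed

lemma nth_root:
  assumes "alg_closed TYPE('k)" "0 < n"
  obtains y :: 'k where "y ^ n = x"
proof -
  have "coeff (monom 1 n - [:x:]) n = 1"
    using assms(2) by (simp add: coeff_pCons split: nat.split)
  then have "n \<le> degree (monom 1 n - [:x:])"
    by (intro le_degree) simp
  then have "\<exists>y. poly (monom 1 n - [:x:]) y = 0"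
    using assms unfolding alg_closed_def by (metis One_nat_def Suc_leI le_trans)
  then show ?thesis
    using that by (auto simp: poly_monom)
qed

text \<open>Roots exist, so the value group contains every rational multiple of a nonzero value. The
  bound \<open>0 \<le> a\<close> makes the rational factor positive, so natural exponents are
  enough.\<close>

lemma val_dense:
  assumes "alg_closed TYPE('k)" "0 \<le> a" "a < b"
  obtains x where "x \<noteq> 0" "a < \<nu> x" "\<nu> x < b"
proof -
  obtain x0 where x0: "x0 \<noteq> 0" "\<nu> x0 \<noteq> 0"
    using nonarch unfolding nonarch_valuation_def by blast
  obtain x where x: "x \<noteq> 0" "\<nu> x > 0"
    using x0 that val_inverse[of x0] by (metis inverse_nonzero_iff_nonzero linorder_neqE neg_0_less_iff_less)
  obtain q :: rat where q: "a / \<nu> x < of_rat q" "of_rat q < b / \<nu> x"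
    using of_rat_dense[of "a / \<nu> x" "b / \<nu> x"] assms(3) x by (auto simp: divide_strict_right_mono)
  have "0 < q"
    using q(1) assms(2) x by (metis divide_nonneg_pos le_less_trans zero_less_of_rat_iff)
  then obtain m n :: nat where mn: "0 < n" "of_rat q = (of_nat m / of_nat n :: real)"
  proof -
    obtain i j where "q = Fract i j" "0 < j"
      by (cases q) auto
    moreover have "0 < i"
      using \<open>0 < q\<close> calculation by (simp add: zero_less_Fract_iff)
    ultimately show ?thesis
      using that[of "nat j" "nat i"] by (simp add: of_rat_rat)
  qed
  obtain y where y: "y ^ n = x"
    using nth_root[OF assms(1) mn(1)] by blast
  have "y \<noteq> 0"
    using y x mn by auto
  then have "\<nu> (y ^ m) = of_rat q * \<nu> x"
    using y mn by (auto simp: val_power field_simps)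
  then show ?thesis
    using that[of "y ^ m"] \<open>y \<noteq> 0\<close> q x by (simp add: field_simps)
qed

end

section \<open>Points with prescribed logarithmic derivatives\<close>

definition term_eval :: "(('n::finite option \<Rightarrow>\<^sub>0 nat) \<Rightarrow>\<^sub>0 'k::comm_ring_1) \<Rightarrow>
    ('n option \<Rightarrow>\<^sub>0 nat) \<Rightarrow> ('n option \<Rightarrow> 'k) \<Rightarrow> 'k" where
  "term_eval f u z = Poly_Mapping.lookup f u * (\<Prod>j\<in>UNIV. z j ^ Poly_Mapping.lookup u j)"

text \<open>The operator x_j d/dx_j multiplies each term by an integer. All derivatives thus become
  integer combinations of the same terms, and linear algebra on exponents applies.\<close>

definition log_deriv :: "(('n::finite option \<Rightarrow>\<^sub>0 nat) \<Rightarrow>\<^sub>0 'k::comm_ring_1) \<Rightarrow>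
    'n option \<Rightarrow> ('n option \<Rightarrow> 'k) \<Rightarrow> 'k" where
  "log_deriv f j z = (\<Sum>u\<in>Poly_Mapping.keys f. of_nat (Poly_Mapping.lookup u j) * term_eval f u z)"

lemma peval_eq_sum: "peval f z = (\<Sum>u\<in>Poly_Mapping.keys f. term_eval f u z)"
  by (simp add: peval_def term_eval_def)

lemma log_deriv_eq_pderiv: "log_deriv f j z = z j * pderiv_eval f j z"
proof -
  have "of_nat (Poly_Mapping.lookup u j) * term_eval f u z =
    z j * (Poly_Mapping.lookup f u * of_nat (Poly_Mapping.lookup u j) *
      (\<Prod>i\<in>UNIV. z i ^ (if i = j then Poly_Mapping.lookup u i - 1 else Poly_Mapping.lookup u i)))" for u
  proof (cases "Poly_Mapping.lookup u j")
    case (Suc m)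
    have "(\<Prod>i\<in>UNIV. z i ^ Poly_Mapping.lookup u i) =
      z j * (\<Prod>i\<in>UNIV. z i ^ (if i = j then Poly_Mapping.lookup u i - 1 else Poly_Mapping.lookup u i))"
      using Suc by (simp add: prod.remove[of UNIV j] mult.assoc)
    then show ?thesis
      by (simp add: term_eval_def algebra_simps)
  qed simp
  then show ?thesis
    by (simp add: log_deriv_def pderiv_eval_def sum_distrib_left)
qed

lemma power_int_sum:
  assumes "(x::'a::field) \<noteq> 0"
  shows "x powi (\<Sum>i\<in>I. m i) = (\<Prod>i\<in>I. x powi m i)"
  by (induction I rule: infinite_finite_induct) (use assms in \<open>auto simp: power_int_add\<close>)

lemma sum_of_int_delta:
  fixes g :: "'i::finite \<Rightarrow> 'k::comm_ring_1"
  shows "(\<Sum>i\<in>UNIV. of_int (if j = i then m else 0) * g i) = of_int m * g j"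
    "(\<Sum>i\<in>UNIV. of_int (if i = j then m else 0) * g i) = of_int m * g j"
proof -
  have "(\<Sum>i\<in>UNIV. of_int (if i = j then m else 0) * g i) = (\<Sum>i\<in>UNIV. if i = j then of_int m * g i else 0)"
    by (intro sum.cong) auto
  then show "(\<Sum>i\<in>UNIV. of_int (if i = j then m else 0) * g i) = of_int m * g j"
    by simp
  then show "(\<Sum>i\<in>UNIV. of_int (if j = i then m else 0) * g i) = of_int m * g j"
    by (simp add: eq_commute)
qed

text \<open>The coordinates \<open>P\<close> lift a vertex of the tropical hypersurface to homogeneous coordinates,
  normalised so that the maximal terms \<open>U k\<close> have valuation \<open>0\<close>; all other terms have valuation
  at least \<open>\<delta>\<close>. The integer matrix \<open>D\<close> is \<open>d\<close> times the inverse of the exponent matrix.\<close>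

locale tropical_simplex = valued \<nu> for \<nu> :: "'k::field_char_0 \<Rightarrow> real" +
  fixes f :: "('n::finite option \<Rightarrow>\<^sub>0 nat) \<Rightarrow>\<^sub>0 'k"
    and d :: nat
    and P :: "'n option \<Rightarrow> real"
    and U :: "'n option \<Rightarrow> 'n option \<Rightarrow>\<^sub>0 nat"
    and D :: "'n option \<Rightarrow> 'n option \<Rightarrow> int"
    and \<delta> :: real
  assumes closed: "alg_closed TYPE('k)"
    and homogeneous: "homogeneous_of_degree f d"
    and d_pos: "0 < d"
    and DU: "(\<Sum>k\<in>UNIV. D i k * int (Poly_Mapping.lookup (U k) j)) = (if i = j then int d else 0)"
    and UD: "(\<Sum>j\<in>UNIV. int (Poly_Mapping.lookup (U k) j) * D j l) = (if k = l then int d else 0)"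
    and inj_U: "inj U"
    and U_keys: "U k \<in> Poly_Mapping.keys f"
    and delta_pos: "0 < \<delta>"
    and val_on: "\<nu> (Poly_Mapping.lookup f (U k)) = (\<Sum>j\<in>UNIV. real (Poly_Mapping.lookup (U k) j) * P j)"
    and val_off: "u \<in> Poly_Mapping.keys f \<Longrightarrow> u \<notin> range U \<Longrightarrow>
      \<delta> \<le> \<nu> (Poly_Mapping.lookup f u) - (\<Sum>j\<in>UNIV. real (Poly_Mapping.lookup u j) * P j)"
begin

definition lifts :: "('n option \<Rightarrow> 'k) \<Rightarrow> bool" where
  "lifts z \<longleftrightarrow> (\<forall>j. z j \<noteq> 0 \<and> \<nu> (z j) = - P j)"

lemma sum_keys_split:
  "(\<Sum>u\<in>Poly_Mapping.keys f. g u) = (\<Sum>k\<in>UNIV. g (U k)) + (\<Sum>u\<in>Poly_Mapping.keys f - range U. g u)"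
proof -
  have "range U \<subseteq> Poly_Mapping.keys f"
    using U_keys by auto
  then have "(\<Sum>u\<in>Poly_Mapping.keys f. g u) =
      (\<Sum>u\<in>range U. g u) + (\<Sum>u\<in>Poly_Mapping.keys f - range U. g u)"
    by (simp add: sum.subset_diff add.commute)
  then show ?thesis
    using inj_U by (simp add: sum.reindex)
qed

lemma val_term:
  assumes "lifts z" "u \<in> Poly_Mapping.keys f"
  shows "term_eval f u z \<noteq> 0"
    "\<nu> (term_eval f u z) = \<nu> (Poly_Mapping.lookup f u) - (\<Sum>j\<in>UNIV. real (Poly_Mapping.lookup u j) * P j)"
proof -
  have z: "z j \<noteq> 0" "\<nu> (z j) = - P j" for j
    using assms by (auto simp: lifts_def)
  have c: "Poly_Mapping.lookup f u \<noteq> 0"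
    using assms by (simp add: in_keys_iff)
  have "\<nu> (\<Prod>j\<in>UNIV. z j ^ Poly_Mapping.lookup u j) = - (\<Sum>j\<in>UNIV. real (Poly_Mapping.lookup u j) * P j)"
    using z by (subst val_prod) (auto simp: val_power sum_negf)
  then show "term_eval f u z \<noteq> 0"
    "\<nu> (term_eval f u z) = \<nu> (Poly_Mapping.lookup f u) - (\<Sum>j\<in>UNIV. real (Poly_Mapping.lookup u j) * P j)"
    using z c by (auto simp: term_eval_def val_mult)
qed

lemma term_on:
  assumes "lifts z"
  shows "term_eval f (U k) z \<noteq> 0" "\<nu> (term_eval f (U k) z) = 0"
  using val_term[OF assms U_keys] val_on by auto

lemma term_off:
  assumes "lifts z" "u \<in> Poly_Mapping.keys f - range U"
  shows "vge (term_eval f u z) \<delta>"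
  using val_term[OF assms(1), of u] val_off assms by (auto simp: vge_def)

lemma term_vge_0:
  assumes "lifts z" "u \<in> Poly_Mapping.keys f"
  shows "vge (term_eval f u z) 0"
  using term_on[OF assms(1)] term_off[OF assms(1)] assms(2) delta_pos
  by (metis (full_types) DiffI imageE less_eq_real_def vge_def vge_mono)

lemma log_deriv_vge_0:
  assumes "lifts z"
  shows "vge (log_deriv f j z) 0"
  unfolding log_deriv_def using assms by (auto intro!: vge_sum vge_mult_left vge_of_nat term_vge_0)

lemma sum_exponents: "u \<in> Poly_Mapping.keys f \<Longrightarrow> (\<Sum>j\<in>UNIV. Poly_Mapping.lookup u j) = d"
  using homogeneous by (simp add: homogeneous_of_degree_def)

lemma euler: "(\<Sum>j\<in>UNIV. log_deriv f j z) = of_nat d * peval f z"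
proof -
  have "(\<Sum>j\<in>UNIV. log_deriv f j z) =
      (\<Sum>u\<in>Poly_Mapping.keys f. (\<Sum>j\<in>UNIV. of_nat (Poly_Mapping.lookup u j)) * term_eval f u z)"
    unfolding log_deriv_def by (subst sum.swap) (simp add: sum_distrib_right)
  also have "\<dots> = (\<Sum>u\<in>Poly_Mapping.keys f. of_nat d * term_eval f u z)"
    by (intro sum.cong refl) (simp flip: of_nat_sum add: sum_exponents)
  finally show ?thesis
    by (simp add: peval_eq_sum sum_distrib_left)
qed

text \<open>By homogeneity the exponent matrix maps the all-ones vector to \<open>d\<close> times
  itself, so its scaled inverse fixes that vector.\<close>

lemma sum_D: "(\<Sum>k\<in>UNIV. D i k) = 1"
proof -
  have row: "(\<Sum>j\<in>UNIV. int (Poly_Mapping.lookup (U k) j)) = int d" for k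
    using sum_exponents[OF U_keys[of k]] by (metis of_nat_sum)
  have "(\<Sum>k\<in>UNIV. D i k) * int d = (\<Sum>k\<in>UNIV. D i k * (\<Sum>j\<in>UNIV. int (Poly_Mapping.lookup (U k) j)))"
    by (simp only: row sum_distrib_right)
  also have "\<dots> = (\<Sum>j\<in>UNIV. \<Sum>k\<in>UNIV. D i k * int (Poly_Mapping.lookup (U k) j))"
    unfolding sum_distrib_left by (rule sum.swap)
  also have "\<dots> = int d"
    by (simp add: DU)
  finally show ?thesis
    using d_pos by simp
qed

text \<open>Maximal terms form a simplex, so a valuation-zero term can be isolated as a
  combination of logarithmic derivatives.\<close>

lemma column_not_constant:
  assumes "lifts z" "peval f z = 0"
  shows "\<exists>i j. \<nu> (log_deriv f i z) \<le> 0 \<and> \<nu> (log_deriv f j z) \<le> 0 \<and> D i k \<noteq> D j k"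
proof (rule ccontr)
  assume neg: "\<not> ?thesis"
  define small where "small = {j. 0 < \<nu> (log_deriv f j z)}"
  have "\<exists>\<kappa>. \<forall>j. j \<notin> small \<longrightarrow> D j k = \<kappa>"
  proof (cases "\<exists>i. i \<notin> small")
    case True
    then obtain i where "i \<notin> small"
      by blast
    then show ?thesis
      using neg unfolding small_def mem_Collect_eq not_less by blast
  qed auto
  then obtain \<kappa> where \<kappa>: "\<And>j. j \<notin> small \<Longrightarrow> D j k = \<kappa>"
    by blast
  define r where "r = Min (insert \<delta> ((\<lambda>j. \<nu> (log_deriv f j z)) ` small))"
  have r: "0 < r" "r \<le> \<delta>" and F: "\<And>j. j \<in> small \<Longrightarrow> vge (log_deriv f j z) r"
    unfolding r_def using delta_pos by (auto simp: small_def vge_def)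
  have "(\<Sum>j\<in>UNIV. of_int (D j k) * log_deriv f j z) =
      (\<Sum>u\<in>Poly_Mapping.keys f. of_int (\<Sum>j\<in>UNIV. int (Poly_Mapping.lookup u j) * D j k) * term_eval f u z)"
    unfolding log_deriv_def sum_distrib_left of_int_sum sum_distrib_right
    by (subst sum.swap) (simp add: mult_ac)
  \<comment> \<open>Shifting the column by \<open>\<kappa>\<close> costs a multiple of Euler's
    relation, which vanishes at a zero of \<open>f\<close>, and it removes all derivatives outside
    \<open>small\<close>.\<close>
  moreover have "(\<Sum>j\<in>UNIV. of_int (D j k - \<kappa>) * log_deriv f j z) =
      (\<Sum>j\<in>UNIV. of_int (D j k) * log_deriv f j z) - of_int \<kappa> * (\<Sum>j\<in>UNIV. log_deriv f j z)"
    by (simp add: sum_distrib_left sum_subtractf left_diff_distrib)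
  ultimately have "(\<Sum>j\<in>UNIV. of_int (D j k - \<kappa>) * log_deriv f j z) =
      (\<Sum>u\<in>Poly_Mapping.keys f. of_int (\<Sum>j\<in>UNIV. int (Poly_Mapping.lookup u j) * D j k) * term_eval f u z)"
    using assms(2) by (simp add: euler)
  also have "\<dots> = of_nat d * term_eval f (U k) z +
    (\<Sum>u\<in>Poly_Mapping.keys f - range U. of_int (\<Sum>j\<in>UNIV. int (Poly_Mapping.lookup u j) * D j k) * term_eval f u z)"
    unfolding sum_keys_split UD by (simp only: sum_of_int_delta of_int_of_nat_eq)
  finally have eq: "of_nat d * term_eval f (U k) z = (\<Sum>j\<in>UNIV. of_int (D j k - \<kappa>) * log_deriv f j z)
    - (\<Sum>u\<in>Poly_Mapping.keys f - range U. of_int (\<Sum>j\<in>UNIV. int (Poly_Mapping.lookup u j) * D j k) * term_eval f u z)"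
    by simp
  have "vge (of_int (D j k - \<kappa>) * log_deriv f j z) r" for j
    using F[of j] \<kappa>[of j] by (cases "j \<in> small") (auto intro!: vge_mult_left vge_of_int simp del: of_int_diff)
  moreover have "vge (of_int (\<Sum>j\<in>UNIV. int (Poly_Mapping.lookup u j) * D j k) * term_eval f u z) r"
    if "u \<in> Poly_Mapping.keys f - range U" for u
    by (intro vge_mult_left[OF vge_of_int] vge_mono[OF term_off[OF assms(1) that] r(2)])
  ultimately have "vge (of_nat d * term_eval f (U k) z) r"
    unfolding eq by (intro vge_diff vge_sum)
  then show False
    using term_on[OF assms(1), of k] d_pos r(1) val_of_int[of "int d"] by (auto simp: vge_def val_mult)
qed

text \<open>The value of the linear form L_j when the maximal terms take the integer values
  \<open>a k\<close>.\<close>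

definition target :: "('n option \<Rightarrow> int) \<Rightarrow> 'n option \<Rightarrow> int" where
  "target a j = (\<Sum>k\<in>UNIV. a k * int (Poly_Mapping.lookup (U k) j))"

text \<open>A monomial system is linear in the exponents. Since \<open>D\<close> inverts the
  exponent matrix only up to the factor \<open>d\<close>, it is applied to \<open>d\<close>-th roots
  \<open>g k\<close> of the prescribed monomial values. Nonzero integers have valuation 0, so the
  valuations of \<open>z\<close> are dictated by the coefficients and equal
  \<open>- P j\<close>.\<close>

lemma initial_point:
  assumes "\<And>k. a k \<noteq> 0"
  obtains z where "lifts z" "\<And>k. term_eval f (U k) z = of_int (a k)"
proof -
  define c where "c k = Poly_Mapping.lookup f (U k)" for k
  have c: "c k \<noteq> 0" for k
    using U_keys by (simp add: c_def in_keys_iff)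
  have "\<exists>y. y ^ d = of_int (a k) / c k" for k
    using nth_root[OF closed d_pos] by metis
  then obtain g where g: "\<And>k. g k ^ d = of_int (a k) / c k"
    by metis
  have g0: "g k \<noteq> 0" for k
    using g[of k] d_pos assms c by (auto simp: zero_power)
  have "real d * \<nu> (g k) = - \<nu> (c k)" for k
    using g0[of k] val_power[of "g k" d] assms[of k] c[of k] by (simp add: g val_divide val_of_int)
  then have vg: "\<nu> (g k) = - \<nu> (c k) / real d" for k
    using d_pos by (simp add: field_simps)
  define z where "z j = (\<Prod>k\<in>UNIV. g k powi D j k)" for j
  have z0: "z j \<noteq> 0" for j
    using g0 by (simp add: z_def)
  have vz: "\<nu> (z j) = (\<Sum>k\<in>UNIV. of_int (D j k) * \<nu> (g k))" for j
    unfolding z_def using g0 by (subst val_prod) (auto simp: val_powi)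
  have "\<nu> (z j) = - P j" for j
  proof -
    have "real d * \<nu> (z j) = - (\<Sum>k\<in>UNIV. of_int (D j k) * \<nu> (c k))"
      using d_pos by (simp add: vz vg sum_distrib_left sum_negf)
    also have "(\<Sum>k\<in>UNIV. of_int (D j k) * \<nu> (c k)) =
        (\<Sum>i\<in>UNIV. \<Sum>k\<in>UNIV. real_of_int (D j k * int (Poly_Mapping.lookup (U k) i)) * P i)"
      unfolding c_def val_on sum_distrib_left by (subst sum.swap) (simp add: mult_ac)
    also have "\<dots> = (\<Sum>i\<in>UNIV. real_of_int (\<Sum>k\<in>UNIV. D j k * int (Poly_Mapping.lookup (U k) i)) * P i)"
      by (simp add: sum_distrib_right)
    also have "\<dots> = real d * P j"
      unfolding DU by (simp only: sum_of_int_delta of_int_of_nat_eq)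
    finally show ?thesis
      using d_pos by (metis (no_types) mult_cancel_left mult_minus_right of_nat_0_eq_iff less_irrefl)
  qed
  then have "lifts z"
    using z0 by (simp add: lifts_def)
  moreover have "term_eval f (U k) z = of_int (a k)" for k
  proof -
    have "(\<Prod>j\<in>UNIV. z j ^ Poly_Mapping.lookup (U k) j) =
        (\<Prod>l\<in>UNIV. \<Prod>j\<in>UNIV. g l powi (int (Poly_Mapping.lookup (U k) j) * D j l))"
      unfolding z_def prod_power_distrib[symmetric]
      by (subst prod.swap) (simp add: power_int_mult mult.commute[of "int _"] prod_power_distrib)
    also have "\<dots> = (\<Prod>l\<in>UNIV. g l powi (\<Sum>j\<in>UNIV. int (Poly_Mapping.lookup (U k) j) * D j l))"
      using g0 by (simp add: power_int_sum)
    also have "\<dots> = g k ^ d"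
      unfolding UD by (simp add: if_distrib cong: if_cong)
    finally show ?thesis
      using c[of k] by (simp add: term_eval_def g c_def)
  qed
  ultimately show ?thesis
    using that by blast
qed

text \<open>Multiplicative perturbations by units preserve all valuations, and to first order they
  multiply each term by an integer linear form in \<open>\<eta>\<close>.\<close>

lemma perturb:
  assumes "lifts z" "0 < r" "\<And>j. vge (\<eta> j) r"
  defines "z' \<equiv> \<lambda>j. z j * (1 + \<eta> j)"
  shows "lifts z'"
    and "u \<in> Poly_Mapping.keys f \<Longrightarrow> vge (term_eval f u z' - term_eval f u z
      - term_eval f u z * (\<Sum>j\<in>UNIV. of_nat (Poly_Mapping.lookup u j) * \<eta> j)) (2 * r)"
    and "u \<in> Poly_Mapping.keys f \<Longrightarrow> vge (term_eval f u z' - term_eval f u z) r"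
    and "vge (log_deriv f j z' - log_deriv f j z) r"
proof -
  have one: "1 + \<eta> j \<noteq> 0 \<and> \<nu> (1 + \<eta> j) = 0" for j
    using val_add_small[of 1 "\<eta> j" r] assms by (simp add: val_one)
  then show "lifts z'"
    using assms(1) by (simp add: lifts_def z'_def val_mult)
  have second: "vge (term_eval f u z' - term_eval f u z
      - term_eval f u z * (\<Sum>j\<in>UNIV. of_nat (Poly_Mapping.lookup u j) * \<eta> j)) (2 * r)"
    if u: "u \<in> Poly_Mapping.keys f" for u
  proof -
    have "vge (term_eval f u z * ((\<Prod>j\<in>UNIV. (1 + \<eta> j) ^ Poly_Mapping.lookup u j) - 1
        - (\<Sum>j\<in>UNIV. of_nat (Poly_Mapping.lookup u j) * \<eta> j))) (2 * r)"
      using assms term_vge_0[OF assms(1) u] by (intro vge_mult_left prod_one_plus_small) auto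
    moreover have "term_eval f u z' = term_eval f u z * (\<Prod>j\<in>UNIV. (1 + \<eta> j) ^ Poly_Mapping.lookup u j)"
      by (simp add: term_eval_def z'_def power_mult_distrib prod.distrib)
    ultimately show ?thesis
      by (simp add: algebra_simps)
  qed
  have first: "vge (term_eval f u z' - term_eval f u z) r"
    if u: "u \<in> Poly_Mapping.keys f" for u
  proof -
    have "vge (term_eval f u z * (\<Sum>j\<in>UNIV. of_nat (Poly_Mapping.lookup u j) * \<eta> j)) r"
      using assms(3) term_vge_0[OF assms(1) u] by (intro vge_mult_left vge_sum vge_of_nat)
    with vge_mono[OF second[OF u], of r] assms(2) show ?thesis
      using vge_add by fastforce
  qed
  show "u \<in> Poly_Mapping.keys f \<Longrightarrow> vge (term_eval f u z' - term_eval f u z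
      - term_eval f u z * (\<Sum>j\<in>UNIV. of_nat (Poly_Mapping.lookup u j) * \<eta> j)) (2 * r)"
    and "u \<in> Poly_Mapping.keys f \<Longrightarrow> vge (term_eval f u z' - term_eval f u z) r"
    using first second by auto
  have "log_deriv f j z' - log_deriv f j z =
      (\<Sum>u\<in>Poly_Mapping.keys f. of_nat (Poly_Mapping.lookup u j) * (term_eval f u z' - term_eval f u z))"
    by (simp add: log_deriv_def sum_subtractf right_diff_distrib)
  then show "vge (log_deriv f j z' - log_deriv f j z) r"
    using first by (auto intro!: vge_sum vge_mult_left vge_of_nat)
qed

text \<open>The logarithmic Hessian at a point with maximal terms \<open>a k\<close> is \<open>U\<^sup>T diag(a) U\<close>.\<close>

lemma solve_hessian:
  assumes "\<And>k. a k \<noteq> 0" "\<And>j. vge (R j) r"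
  shows "\<exists>\<eta>. (\<forall>j. vge (\<eta> j) r) \<and>
    (\<forall>j. (\<Sum>k\<in>UNIV. of_nat (Poly_Mapping.lookup (U k) j) * (of_int (a k) *
      (\<Sum>i\<in>UNIV. of_nat (Poly_Mapping.lookup (U k) i) * \<eta> i))) = R j)"
proof -
  \<comment> \<open>The inverse of the Hessian is applied factor by factor: \<open>\<xi>\<close>
    inverts the transposed exponent matrix, \<open>\<eta>\<close> then divides by \<open>a\<close>
    and inverts the exponent matrix. The only divisors are nonzero integers, so the bound
    \<open>r\<close> survives.\<close>
  define \<xi> where "\<xi> k = (\<Sum>j\<in>UNIV. R j * of_int (D j k)) / of_int (int d)" for k
  define \<eta> where "\<eta> i = (\<Sum>k\<in>UNIV. of_int (D i k) * (\<xi> k / of_int (a k))) / of_int (int d)" for i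
  have "vge (\<xi> k) r" for k
    unfolding \<xi>_def using assms d_pos
    by (intro vge_divide_int vge_sum) (auto intro!: vge_mult_right vge_of_int)
  then have vge: "vge (\<eta> i) r" for i
    unfolding \<eta>_def using assms d_pos
    by (intro vge_divide_int vge_sum) (auto intro!: vge_mult_left vge_divide_int vge_of_int)
  have "(\<Sum>i\<in>UNIV. of_nat (Poly_Mapping.lookup (U k) i) * \<eta> i) =
      (\<Sum>l\<in>UNIV. of_int (\<Sum>i\<in>UNIV. int (Poly_Mapping.lookup (U k) i) * D i l) * (\<xi> l / of_int (a l))) / of_int (int d)" for k
    unfolding \<eta>_def of_int_sum sum_distrib_right sum_divide_distrib sum_distrib_left times_divide_eq_right
    by (subst sum.swap) (simp add: mult_ac)
  then have inner: "of_int (a k) * (\<Sum>i\<in>UNIV. of_nat (Poly_Mapping.lookup (U k) i) * \<eta> i) = \<xi> k" for k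
    unfolding UD sum_of_int_delta using d_pos assms(1) by simp
  have "(\<Sum>k\<in>UNIV. of_nat (Poly_Mapping.lookup (U k) j) * \<xi> k) =
      (\<Sum>i\<in>UNIV. of_int (\<Sum>k\<in>UNIV. D i k * int (Poly_Mapping.lookup (U k) j)) * R i) / of_int (int d)" for j
    unfolding \<xi>_def of_int_sum sum_distrib_right sum_divide_distrib sum_distrib_left times_divide_eq_right
    by (subst sum.swap) (simp add: mult_ac)
  then have outer: "(\<Sum>k\<in>UNIV. of_nat (Poly_Mapping.lookup (U k) j) * \<xi> k) = R j" for j
    unfolding DU sum_of_int_delta using d_pos by simp
  show ?thesis
    using vge by (intro exI[of _ \<eta>]) (simp add: inner outer)
qed

text \<open>The linear system is solved with the integers \<open>a k\<close> in place of the actual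
  maximal terms. That replacement and the terms outside the simplex each leave an error of order
  \<open>r + \<delta>\<close>, and the quadratic error \<open>2 * r\<close> is no worse because
  \<open>\<delta> \<le> r\<close>. Closeness of the terms to \<open>a\<close> is carried along so
  that the same \<open>a\<close> serves in the next step.\<close>

lemma newton_step:
  assumes a: "\<And>k. a k \<noteq> 0" and z: "lifts z" and r: "\<delta> \<le> r"
    and on: "\<And>k. vge (term_eval f (U k) z - of_int (a k)) \<delta>"
    and res: "\<And>j. vge (log_deriv f j z - \<rho> j) r"
  obtains z' where "lifts z'" "\<And>k. vge (term_eval f (U k) z' - of_int (a k)) \<delta>"
    "\<And>j. vge (log_deriv f j z' - \<rho> j) (r + \<delta>)"
proof -
  have R: "vge (\<rho> j - log_deriv f j z) r" for j
    using vge_minus[OF res[of j]] by simp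
  obtain \<eta> where \<eta>: "\<And>j. vge (\<eta> j) r"
    and H: "\<And>j. (\<Sum>k\<in>UNIV. of_nat (Poly_Mapping.lookup (U k) j) * (of_int (a k) *
      (\<Sum>i\<in>UNIV. of_nat (Poly_Mapping.lookup (U k) i) * \<eta> i))) = \<rho> j - log_deriv f j z"
    using solve_hessian[where a = a and R = "\<lambda>j. \<rho> j - log_deriv f j z" and r = r, OF a R] by blast
  define z' where "z' = (\<lambda>j. z j * (1 + \<eta> j))"
  define s where "s u = (\<Sum>i\<in>UNIV. of_nat (Poly_Mapping.lookup u i) * \<eta> i)" for u
  have r0: "0 < r"
    using r delta_pos by simp
  have p: "lifts z'"
    "\<And>u. u \<in> Poly_Mapping.keys f \<Longrightarrow> vge (term_eval f u z' - term_eval f u z - term_eval f u z * s u) (2 * r)"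
    "\<And>u. u \<in> Poly_Mapping.keys f \<Longrightarrow> vge (term_eval f u z' - term_eval f u z) r"
    unfolding z'_def s_def using perturb(1-3)[OF z r0, of \<eta>] \<eta> by auto
  have s: "vge (s u) r" for u
    unfolding s_def using \<eta> by (intro vge_sum vge_mult_left vge_of_nat)
  have "vge (term_eval f (U k) z' - of_int (a k)) \<delta>" for k
  proof -
    have "vge ((term_eval f (U k) z' - term_eval f (U k) z) + (term_eval f (U k) z - of_int (a k))) \<delta>"
      by (intro vge_add on vge_mono[OF p(3)[OF U_keys] r])
    then show ?thesis
      by simp
  qed
  moreover have "vge (log_deriv f j z' - \<rho> j) (r + \<delta>)" for j
  proof -
    define c where "c u = (of_nat (Poly_Mapping.lookup u j) :: 'k)" for u
    have "(\<Sum>u\<in>Poly_Mapping.keys f. c u * (term_eval f u z * s u)) =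
        (\<Sum>k\<in>UNIV. c (U k) * (of_int (a k) * s (U k))) +
        ((\<Sum>k\<in>UNIV. c (U k) * ((term_eval f (U k) z - of_int (a k)) * s (U k))) +
        (\<Sum>u\<in>Poly_Mapping.keys f - range U. c u * (term_eval f u z * s u)))"
      unfolding sum_keys_split add.assoc[symmetric] sum.distrib[symmetric]
      by (simp add: algebra_simps)
    moreover have "(\<Sum>k\<in>UNIV. c (U k) * (of_int (a k) * s (U k))) = \<rho> j - log_deriv f j z"
      using H[of j] by (simp add: c_def s_def)
    ultimately have "log_deriv f j z' - \<rho> j =
        (\<Sum>u\<in>Poly_Mapping.keys f. c u * (term_eval f u z' - term_eval f u z - term_eval f u z * s u)) +
        ((\<Sum>k\<in>UNIV. c (U k) * ((term_eval f (U k) z - of_int (a k)) * s (U k))) +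
        (\<Sum>u\<in>Poly_Mapping.keys f - range U. c u * (term_eval f u z * s u)))"
      by (simp add: log_deriv_def c_def sum_subtractf right_diff_distrib)
    moreover have "vge (\<Sum>u\<in>Poly_Mapping.keys f. c u * (term_eval f u z' - term_eval f u z - term_eval f u z * s u)) (r + \<delta>)"
      unfolding c_def using r by (intro vge_sum vge_mult_left vge_of_nat vge_mono[OF p(2)]) auto
    moreover have "vge (\<Sum>k\<in>UNIV. c (U k) * ((term_eval f (U k) z - of_int (a k)) * s (U k))) (r + \<delta>)"
      unfolding c_def add.commute[of r] by (intro vge_sum vge_mult_left[OF vge_of_nat] vge_mult on s)
    moreover have "vge (\<Sum>u\<in>Poly_Mapping.keys f - range U. c u * (term_eval f u z * s u)) (r + \<delta>)"
      unfolding c_def add.commute[of r] by (intro vge_sum vge_mult_left[OF vge_of_nat] vge_mult term_off[OF z] s)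
    ultimately show ?thesis
      by (simp only: vge_add)
  qed
  ultimately show ?thesis
    using that p(1) by blast
qed

lemma approximate_solution:
  assumes a: "\<And>k. a k \<noteq> 0" and \<rho>: "\<And>j. vge (of_int (target a j) - \<rho> j) \<delta>"
  obtains z where "lifts z" "\<And>j. vge (log_deriv f j z - \<rho> j) N"
proof -
  have "\<exists>z. lifts z \<and> (\<forall>k. vge (term_eval f (U k) z - of_int (a k)) \<delta>) \<and>
      (\<forall>j. vge (log_deriv f j z - \<rho> j) (\<delta> + real m * \<delta>))" for m
  proof (induction m)
    case 0
    obtain z where z: "lifts z" "\<And>k. term_eval f (U k) z = of_int (a k)"
      using initial_point[of a] a by blast
    have "log_deriv f j z - \<rho> j = (of_int (target a j) - \<rho> j) +
        (\<Sum>u\<in>Poly_Mapping.keys f - range U. of_nat (Poly_Mapping.lookup u j) * term_eval f u z)" for j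
      by (simp add: log_deriv_def sum_keys_split z target_def mult.commute)
    then have "vge (log_deriv f j z - \<rho> j) \<delta>" for j
      using \<rho>[of j] term_off[OF z(1)] by (simp only:) (intro vge_add vge_sum vge_mult_left vge_of_nat)
    then show ?case
      using z by auto
  next
    case (Suc m)
    then obtain z where z: "lifts z" "\<And>k. vge (term_eval f (U k) z - of_int (a k)) \<delta>"
      "\<And>j. vge (log_deriv f j z - \<rho> j) (\<delta> + real m * \<delta>)"
      by blast
    have "\<delta> \<le> \<delta> + real m * \<delta>"
      using delta_pos by simp
    from newton_step[OF a z(1) this z(2,3)] show ?case
      by (simp add: algebra_simps) metis
  qed
  moreover obtain m where "N < real m * \<delta>"
    using reals_Archimedean3[OF delta_pos] by blast
  moreover have "N \<le> \<delta> + real m * \<delta>" if "N < real m * \<delta>" for m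
    using that delta_pos by simp
  ultimately show ?thesis
    using that by (meson vge_mono)
qed

text \<open>Approximate solutions lie near \<open>f = 0\<close> by Euler's formula; moving a single coordinate
  then solves \<open>f = 0\<close> exactly.\<close>

lemma exact_solution:
  assumes a: "\<And>k. a k \<noteq> 0" and \<rho>: "\<And>j. vge (of_int (target a j) - \<rho> j) \<delta>"
    and sum: "(\<Sum>j\<in>UNIV. \<rho> j) = 0" and N: "0 < N"
  obtains z where "lifts z" "peval f z = 0" "\<And>j. vge (log_deriv f j z - \<rho> j) N"
proof -
  \<comment> \<open>The coordinate that will be moved must have a logarithmic derivative of
    valuation 0; a nonzero integer target ensures this. Not all targets vanish, since the exponent
    matrix is invertible and \<open>a\<close> is nonzero.\<close>
  obtain i where i: "target a i \<noteq> 0"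
  proof (rule ccontr)
    assume "\<not> thesis"
    then have *: "target a i = 0" for i
      using that by blast
    have "int d * a k = (\<Sum>j\<in>UNIV. target a j * D j k)" for k
    proof -
      have "(\<Sum>j\<in>UNIV. target a j * D j k) =
          (\<Sum>l\<in>UNIV. a l * (\<Sum>j\<in>UNIV. int (Poly_Mapping.lookup (U l) j) * D j k))"
        unfolding target_def sum_distrib_left sum_distrib_right
        by (subst sum.swap) (simp add: mult_ac)
      then show ?thesis
        by (simp add: UD if_distrib[of "\<lambda>x. _ * x"] cong: if_cong)
    qed
    then show False
      using a d_pos * by simp
  qed
  \<comment> \<open>Precision at least \<open>\<delta>\<close> is required even for small
    \<open>N\<close>, to compare \<open>log_deriv f i z\<close> with its integer target.\<close>
  define N' where "N' = max N \<delta>"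
  obtain z where z: "lifts z" "\<And>j. vge (log_deriv f j z - \<rho> j) N'"
    using approximate_solution[of a \<rho> N'] a \<rho> by blast
  have "vge (\<Sum>j\<in>UNIV. log_deriv f j z - \<rho> j) N'"
    using z by (intro vge_sum)
  then have "vge (of_int (int d) * peval f z / of_int (int d)) N'"
    using d_pos by (intro vge_divide_int) (simp_all add: sum_subtractf sum euler)
  then have f0: "vge (peval f z) N'"
    using d_pos by simp
  have "vge ((log_deriv f i z - \<rho> i) - (of_int (target a i) - \<rho> i)) \<delta>"
    using vge_mono[OF z(2), of \<delta> i] \<rho>[of i] by (intro vge_diff[of _ _ "of_int (target a i) - \<rho> i"]) (auto simp: N'_def)
  then have Fi: "log_deriv f i z \<noteq> 0" "\<nu> (log_deriv f i z) = 0"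
    using val_add_small[of "of_int (target a i)" "log_deriv f i z - of_int (target a i)" \<delta>] i delta_pos
    by (auto simp: val_of_int)
  \<comment> \<open>This is \<open>f\<close> at the point with \<open>z i\<close> replaced by
    \<open>z i * (1 + h)\<close>, as a polynomial in \<open>h\<close>; its two lowest coefficients
    are \<open>peval f z\<close> and \<open>log_deriv f i z\<close>.\<close>
  define g where "g = (\<Sum>u\<in>Poly_Mapping.keys f. smult (term_eval f u z) ([:1, 1:] ^ Poly_Mapping.lookup u i))"
  have c0: "coeff ([:1, 1:] ^ n) 0 = (1::'k)" for n
    by (induction n) simp_all
  have c1: "coeff ([:1, 1:] ^ n) 1 = (of_nat n :: 'k)" for n
    by (induction n) (simp_all add: c0)
  have "coeff g 0 = peval f z" "coeff g 1 = log_deriv f i z"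
    unfolding g_def coeff_sum coeff_smult c0 c1 peval_eq_sum log_deriv_def by (simp_all add: mult.commute)
  then obtain h where h: "poly g h = 0" "vge h N'"
    using small_root[OF closed, of g N'] Fi f0 by metis
  define \<eta> where "\<eta> j = (if j = i then h else 0)" for j
  define z' where "z' = (\<lambda>j. z j * (1 + \<eta> j))"
  have "0 < N'"
    using N by (simp add: N'_def)
  moreover have "vge (\<eta> j) N'" for j
    using h(2) by (simp add: \<eta>_def)
  ultimately have p: "lifts z'" "\<And>j. vge (log_deriv f j z' - log_deriv f j z) N'"
    unfolding z'_def using perturb(1,4)[OF z(1)] by blast+
  have "term_eval f u z' = term_eval f u z * (1 + h) ^ Poly_Mapping.lookup u i" for u
  proof -
    have "(\<Prod>j\<in>UNIV. (1 + \<eta> j) ^ Poly_Mapping.lookup u j) = (1 + h) ^ Poly_Mapping.lookup u i"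
      by (simp add: \<eta>_def prod.remove[of UNIV i])
    then show ?thesis
      by (simp add: term_eval_def z'_def power_mult_distrib prod.distrib)
  qed
  then have "peval f z' = poly g h"
    by (simp add: peval_eq_sum g_def poly_sum)
  moreover have "vge (log_deriv f j z' - \<rho> j) N" for j
    using vge_add[OF p(2)[of j] z(2)[of j]] by (auto simp: N'_def intro: vge_mono)
  ultimately show ?thesis
    using that p(1) h(1) by simp
qed

end

section \<open>Auxiliary facts: integers avoiding finitely many zeros, the vectors
  \<open>evec\<close>, homogeneity\<close>

lemma exists_int_avoiding:
  fixes A B :: "'i \<Rightarrow> int"
  assumes "finite I" "\<And>i. i \<in> I \<Longrightarrow> A i \<noteq> 0 \<or> B i \<noteq> 0"
  obtains N where "\<And>i. i \<in> I \<Longrightarrow> A i + N * B i \<noteq> 0"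
proof -
  have "finite {N. A i + N * B i = 0}" if "i \<in> I" for i
  proof (cases "B i = 0")
    case True
    then show ?thesis
      using assms(2)[OF that] by simp
  next
    case False
    have "N = - A i div B i" if "A i + N * B i = 0" for N
    proof -
      have "- A i = N * B i"
        using that by linarith
      then show ?thesis
        using False by simp
    qed
    then have "{N. A i + N * B i = 0} \<subseteq> {- A i div B i}"
      by blast
    then show ?thesis
      by (rule finite_subset) simp
  qed
  then have "finite (\<Union>i\<in>I. {N. A i + N * B i = 0})"
    using assms(1) by blast
  then obtain N where "N \<notin> (\<Union>i\<in>I. {N. A i + N * B i = 0})"
    using ex_new_if_finite infinite_UNIV_int by blast
  then show ?thesis
    using that by blast
qed

lemma sum_UNIV_option: "(\<Sum>j\<in>(UNIV :: 'n::finite option set). g j) = g None + (\<Sum>i\<in>UNIV. g (Some i))"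
  by (simp add: UNIV_option_conv sum.reindex)

lemma sum_evec_nth: "(\<Sum>j\<in>UNIV. t j *\<^sub>R evec j) $ i = t (Some i) - t None"
  for t :: "'n::finite option \<Rightarrow> real"
proof -
  have "(\<Sum>j\<in>UNIV. t j *\<^sub>R evec j) $ i = - t None + (\<Sum>l\<in>UNIV. if l = i then t (Some l) else 0)"
    by (simp add: sum_UNIV_option evec_def axis_def if_distrib[of "\<lambda>x. _ * x"] cong: if_cong)
  then show ?thesis
    by simp
qed

lemma sum_evec_subset:
  "(\<Sum>j\<in>J. t j *\<^sub>R evec j) = (\<Sum>j\<in>UNIV. (if j \<in> J then t j else 0) *\<^sub>R evec j)"
  for J :: "'n::finite option set"
  by (intro sum.mono_neutral_cong_left) auto

lemma span_evec_image:
  assumes "x \<in> span (evec ` J)"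
  obtains v where "\<And>j. j \<notin> J \<Longrightarrow> v j = 0" "x = (\<Sum>j\<in>UNIV. v j *\<^sub>R evec j)"
proof -
  define V where "V = {\<Sum>j\<in>UNIV. v j *\<^sub>R evec j | v. \<forall>j. j \<notin> J \<longrightarrow> v j = 0}"
  have "evec j \<in> V" if "j \<in> J" for j
  proof -
    have "evec j = (\<Sum>i\<in>UNIV. (if i = j then 1 else 0) *\<^sub>R evec i)"
      by (simp add: if_distrib[of "\<lambda>x. x *\<^sub>R _"] cong: if_cong)
    then show ?thesis
      using that unfolding V_def by fastforce
  qed
  moreover have "subspace V"
  proof (rule subspaceI)
    show "0 \<in> V"
      unfolding V_def by (auto intro: exI[of _ "\<lambda>_. 0"])
  next
    fix x y assume "x \<in> V" "y \<in> V"
    then obtain v w where "\<forall>j. j \<notin> J \<longrightarrow> v j = 0" "x = (\<Sum>j\<in>UNIV. v j *\<^sub>R evec j)"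
      "\<forall>j. j \<notin> J \<longrightarrow> w j = 0" "y = (\<Sum>j\<in>UNIV. w j *\<^sub>R evec j)"
      unfolding V_def by blast
    then show "x + y \<in> V"
      unfolding V_def by (auto intro!: exI[of _ "\<lambda>j. v j + w j"] simp: sum.distrib scaleR_add_left)
  next
    fix c x assume "x \<in> V"
    then obtain v where "\<forall>j. j \<notin> J \<longrightarrow> v j = 0" "x = (\<Sum>j\<in>UNIV. v j *\<^sub>R evec j)"
      unfolding V_def by blast
    then show "c *\<^sub>R x \<in> V"
      unfolding V_def by (auto intro!: exI[of _ "\<lambda>j. c * v j"] simp: scaleR_sum_right)
  qed
  ultimately have "span (evec ` J) \<subseteq> V"
    by (intro span_minimal) auto
  then show ?thesis
    using assms that unfolding V_def by auto
qed

lemma homogeneous_scale: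
  assumes "homogeneous_of_degree f d"
  shows "peval f (\<lambda>j. c * z j) = c ^ d * peval f z"
    and "log_deriv f j (\<lambda>j. c * z j) = c ^ d * log_deriv f j z"
proof -
  have *: "term_eval f u (\<lambda>j. c * z j) = c ^ d * term_eval f u z" if "u \<in> Poly_Mapping.keys f" for u
  proof -
    have "(\<Prod>j\<in>UNIV. c ^ Poly_Mapping.lookup u j) = c ^ d"
      using assms that by (simp add: homogeneous_of_degree_def flip: power_sum)
    then show ?thesis
      by (simp add: term_eval_def power_mult_distrib prod.distrib)
  qed
  show "peval f (\<lambda>j. c * z j) = c ^ d * peval f z"
    by (simp add: peval_eq_sum * sum_distrib_left)
  show "log_deriv f j (\<lambda>j. c * z j) = c ^ d * log_deriv f j z"
    by (simp add: log_deriv_def * sum_distrib_left mult.left_commute)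
qed

section \<open>Integer vectors with prescribed zeros and points realizing them\<close>

context tropical_simplex
begin

definition splits :: "'n option set \<Rightarrow> bool" where
  "splits J \<longleftrightarrow> (\<forall>k. \<exists>i j. i \<notin> J \<and> j \<notin> J \<and> D i k \<noteq> D j k)"

text \<open>Here \<open>l\<close> prescribes the L_j up to the factor \<open>d\<close>, and the sums
  against the columns of \<open>D\<close> are the corresponding values of the maximal terms: these
  must be nonzero, and Euler's relation forces the total of \<open>l\<close> to be zero.\<close>

definition generic :: "'n option set \<Rightarrow> ('n option \<Rightarrow> int) \<Rightarrow> bool" where
  "generic J l \<longleftrightarrow> (\<forall>j\<in>J. l j = 0) \<and> (\<Sum>j\<in>UNIV. l j) = 0 \<and> (\<forall>k. (\<Sum>j\<in>UNIV. l j * D j k) \<noteq> 0)"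

text \<open>Columns are treated one at a time. For a column separating \<open>i\<close> from
  \<open>j\<close>, the vector e_i - e_j has nonzero pairing with it, and a suitable integer
  multiple can be added without destroying the pairings already secured.\<close>

lemma splits_imp_generic:
  assumes "splits J"
  obtains l where "generic J l"
proof -
  have "\<exists>l. (\<forall>j\<in>J. l j = 0) \<and> (\<Sum>j\<in>UNIV. l j) = 0 \<and> (\<forall>k\<in>K. (\<Sum>j\<in>UNIV. l j * D j k) \<noteq> 0)"
    if "finite K" for K
    using that
  proof (induction K rule: finite_induct)
    case empty
    then show ?case
      by (intro exI[of _ "\<lambda>_. 0"]) simp
  next
    case (insert k K)
    then obtain l where l: "\<And>j. j \<in> J \<Longrightarrow> l j = 0" "(\<Sum>j\<in>UNIV. l j) = 0"
      "\<And>k. k \<in> K \<Longrightarrow> (\<Sum>j\<in>UNIV. l j * D j k) \<noteq> 0"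
      by blast
    obtain i j where ij: "i \<notin> J" "j \<notin> J" "D i k \<noteq> D j k"
      using assms unfolding splits_def by blast
    define m where "m x = (if x = i then 1 else 0) - (if x = j then 1 else (0::int))" for x
    have m: "(\<Sum>x\<in>UNIV. m x) = 0" "(\<Sum>x\<in>UNIV. m x * D x k) = D i k - D j k"
      by (simp_all add: m_def sum_subtractf left_diff_distrib if_distrib[of "\<lambda>x. x * _"] cong: if_cong)
    have "(\<Sum>x\<in>UNIV. l x * D x k') \<noteq> 0 \<or> (\<Sum>x\<in>UNIV. m x * D x k') \<noteq> 0"
      if "k' \<in> insert k K" for k'
      using that l(3) m(2) ij(3) by auto
    then obtain N where N: "\<And>k'. k' \<in> insert k K \<Longrightarrow>
        (\<Sum>x\<in>UNIV. l x * D x k') + N * (\<Sum>x\<in>UNIV. m x * D x k') \<noteq> 0"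
      using exists_int_avoiding[of "insert k K" "\<lambda>k'. \<Sum>x\<in>UNIV. l x * D x k'"
          "\<lambda>k'. \<Sum>x\<in>UNIV. m x * D x k'"] insert(1) by auto
    have "(\<Sum>x\<in>UNIV. (l x + N * m x) * D x k') =
        (\<Sum>x\<in>UNIV. l x * D x k') + N * (\<Sum>x\<in>UNIV. m x * D x k')" for k'
      by (simp add: sum.distrib distrib_right sum_distrib_left mult.assoc)
    moreover have "(\<Sum>x\<in>UNIV. l x + N * m x) = 0"
      using l(2) m(1) by (simp add: sum.distrib flip: sum_distrib_left)
    moreover have "l x + N * m x = 0" if "x \<in> J" for x
      using l(1) that ij by (auto simp: m_def)
    ultimately show ?case
      using N by (intro exI[of _ "\<lambda>x. l x + N * m x"]) auto
  qed
  from this[of UNIV] show ?thesis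
    using that unfolding generic_def by auto
qed

text \<open>A column constant on the support of \<open>l\<close> pairs with \<open>l\<close> to a
  multiple of the sum of \<open>l\<close>, which is zero. The conclusion concerns the full zero set
  of \<open>l\<close>, which for maximal \<open>J\<close> is thereby forced to be
  \<open>J\<close>.\<close>

lemma generic_imp_splits:
  assumes "generic J l"
  shows "splits {j. l j = 0}"
proof (rule ccontr)
  assume "\<not> ?thesis"
  then obtain k where k: "\<And>i j. l i \<noteq> 0 \<Longrightarrow> l j \<noteq> 0 \<Longrightarrow> D i k = D j k"
    unfolding splits_def by auto
  obtain i where i: "l i \<noteq> 0"
    using assms unfolding generic_def by fastforce
  have "(\<Sum>j\<in>UNIV. l j * D j k) = (\<Sum>j\<in>UNIV. l j * D i k)"
    using k[OF _ i] by (intro sum.cong) auto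
  then show False
    using assms unfolding generic_def by (simp flip: sum_distrib_right)
qed

lemma realize_valuations:
  assumes l: "generic J l" and nz: "\<And>j. j \<notin> J \<Longrightarrow> l j \<noteq> 0"
    and \<epsilon>: "\<And>j. j \<in> J \<Longrightarrow> \<epsilon> j \<noteq> 0 \<and> 0 < \<nu> (\<epsilon> j)"
  obtains z where "lifts z" "peval f z = 0" "\<And>j. log_deriv f j z \<noteq> 0"
    "\<And>j. \<nu> (log_deriv f j z) = (if j \<in> J then \<nu> (\<epsilon> j) else 0)"
proof -
  define a where "a k = (\<Sum>j\<in>UNIV. l j * D j k)" for k
  have a: "a k \<noteq> 0" for k
    using l by (simp add: generic_def a_def)
  have "target a j = (\<Sum>i\<in>UNIV. l i * (\<Sum>k\<in>UNIV. D i k * int (Poly_Mapping.lookup (U k) j)))" for j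
    unfolding target_def a_def sum_distrib_left sum_distrib_right by (subst sum.swap) (simp add: mult_ac)
  then have target: "target a j = int d * l j" for j
    by (simp add: DU if_distrib[of "\<lambda>x. _ * x"] mult.commute cong: if_cong)
  \<comment> \<open>A coordinate outside \<open>J\<close> absorbs minus the sum of the
    \<open>\<epsilon> i\<close>, so that the targets \<open>\<rho>\<close> add up to zero; its own
    valuation stays 0.\<close>
  obtain j0 where j0: "j0 \<notin> J"
    using l a unfolding generic_def by fastforce
  define \<delta>' where "\<delta>' = Min (insert \<delta> ((\<lambda>j. \<nu> (\<epsilon> j)) ` J))"
  have \<delta>': "0 < \<delta>'" "\<delta>' \<le> \<delta>" "\<And>j. j \<in> J \<Longrightarrow> \<delta>' \<le> \<nu> (\<epsilon> j)"
    using \<epsilon> delta_pos by (auto simp: \<delta>'_def)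
  \<comment> \<open>The gap is only a lower bound and may be shrunk until each
    \<open>\<epsilon> j\<close> counts as a small error; \<open>lifts\<close> and
    \<open>target\<close> do not depend on it.\<close>
  interpret small: tropical_simplex \<nu> f d P U D \<delta>'
    using closed homogeneous d_pos DU UD inj_U U_keys \<delta>' val_on val_off
    by unfold_locales (auto intro: order_trans)
  define \<rho> where "\<rho> j = (if j \<in> J then \<epsilon> j else of_int (int d * l j) - (if j = j0 then \<Sum>i\<in>J. \<epsilon> i else 0))" for j
  have \<epsilon>J: "vge (\<Sum>i\<in>J. \<epsilon> i) \<delta>'"
    using \<delta>'(3) by (intro vge_sum) (auto simp: vge_def)
  have close: "vge (of_int (target a j) - \<rho> j) \<delta>'" for j
  proof (cases "j \<in> J")
    case True
    then have "target a j = 0"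
      using l by (simp add: target generic_def)
    then show ?thesis
      using True \<delta>'(3)[of j] by (auto simp: \<rho>_def vge_def val_minus)
  qed (use \<epsilon>J in \<open>auto simp: \<rho>_def target\<close>)
  have "\<rho> j = of_int (int d * l j) + ((if j \<in> J then \<epsilon> j else 0) - (if j = j0 then \<Sum>i\<in>J. \<epsilon> i else 0))" for j
    using l j0 by (auto simp: \<rho>_def generic_def)
  then have "(\<Sum>j\<in>UNIV. \<rho> j) = of_int (int d * (\<Sum>j\<in>UNIV. l j)) + ((\<Sum>j\<in>J. \<epsilon> j) - (\<Sum>i\<in>J. \<epsilon> i))"
    by (simp add: sum.distrib sum_subtractf sum_distrib_left sum.If_cases)
  moreover have "(\<Sum>j\<in>UNIV. l j) = 0"
    using l by (simp add: generic_def)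
  ultimately have sum: "(\<Sum>j\<in>UNIV. \<rho> j) = 0"
    by (simp only: mult_zero_right of_int_0 add_0 diff_self)
  \<comment> \<open>Beyond every \<open>\<nu> (\<epsilon> j)\<close>, so that the final error cannot
    change the valuation of any \<open>\<rho> j\<close>.\<close>
  define N where "N = 1 + Max (insert 0 ((\<lambda>j. \<nu> (\<epsilon> j)) ` J))"
  have Max: "x \<le> Max (insert 0 ((\<lambda>j. \<nu> (\<epsilon> j)) ` J))" if "x \<in> insert 0 ((\<lambda>j. \<nu> (\<epsilon> j)) ` J)" for x
    using that by (intro Max_ge) auto
  have N: "0 < N"
    using Max[OF insertI1] unfolding N_def by linarith
  have N': "\<nu> (\<epsilon> j) < N" if "j \<in> J" for j
    using Max[OF insertI2[OF imageI[OF that]]] unfolding N_def by linarith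
  have "\<exists>z. lifts z \<and> peval f z = 0 \<and> (\<forall>j. vge (log_deriv f j z - \<rho> j) N)"
    by (rule small.exact_solution[where a = a and \<rho> = \<rho> and N = N, OF a close sum N]) blast
  then obtain z where z: "lifts z" "peval f z = 0" "\<And>j. vge (log_deriv f j z - \<rho> j) N"
    by blast
  have \<rho>: "\<rho> j \<noteq> 0 \<and> \<nu> (\<rho> j) = (if j \<in> J then \<nu> (\<epsilon> j) else 0)" for j
  proof (cases "j \<in> J")
    case False
    then have nz': "int d * l j \<noteq> 0"
      using nz d_pos by simp
    have "vge (- (if j = j0 then \<Sum>i\<in>J. \<epsilon> i else 0)) \<delta>'"
      using \<epsilon>J vge_minus by auto
    then show ?thesis
      using val_add_small[of "of_int (int d * l j)" "- (if j = j0 then \<Sum>i\<in>J. \<epsilon> i else 0)" \<delta>']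
        False nz' \<delta>'(1) val_of_int[OF nz'] by (simp add: \<rho>_def del: of_int_mult)
  qed (use \<epsilon> in \<open>auto simp: \<rho>_def\<close>)
  have "\<nu> (\<rho> j) < N" for j
    using \<rho>[of j] N N'[of j] by (cases "j \<in> J") auto
  then have F: "log_deriv f j z \<noteq> 0" "\<nu> (log_deriv f j z) = \<nu> (\<rho> j)" for j
    using val_add_small[OF conjunct1[OF \<rho>] z(3), of j j] by simp_all
  have V: "\<nu> (log_deriv f j z) = (if j \<in> J then \<nu> (\<epsilon> j) else 0)" for j
    using F(2) \<rho> by metis
  show ?thesis
    by (rule that[OF z(1,2) F(1) V])
qed

end

section \<open>Edges and tangents at a vertex\<close>

locale tropical_vertex = tropical_simplex \<nu> f d P U D \<delta>
  for \<nu> :: "'k::field_char_0 \<Rightarrow> real"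
    and f :: "('n::finite option \<Rightarrow>\<^sub>0 nat) \<Rightarrow>\<^sub>0 'k"
    and d P U D \<delta> +
  fixes p :: "real^'n"
  assumes P_p: "P (Some i) = P None + p $ i"
    and vertex: "trop_vertex \<nu> f p"
begin

text \<open>\<open>proj_real\<close> forgets the exponent of x_0, while \<open>evec None\<close> is
  minus the sum of the basis vectors; homogeneity restores the missing exponent at the price of a
  term independent of \<open>u\<close>.\<close>

lemma inner_proj_real:
  assumes "u \<in> Poly_Mapping.keys f"
  shows "proj_real u \<bullet> (\<Sum>j\<in>UNIV. v j *\<^sub>R evec j) = (\<Sum>j\<in>UNIV. real (Poly_Mapping.lookup u j) * v j) - real d * v None"
proof -
  have "real d = real (Poly_Mapping.lookup u None) + (\<Sum>i\<in>UNIV. real (Poly_Mapping.lookup u (Some i)))"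
    using sum_exponents[OF assms] unfolding sum_UNIV_option by (metis of_nat_add of_nat_sum)
  then show ?thesis
    unfolding inner_vec_def proj_real_def sum_evec_nth
    by (simp add: sum_UNIV_option right_diff_distrib sum_subtractf distrib_right sum_distrib_right)
qed

lemma p_eq_sum: "p = (\<Sum>j\<in>UNIV. P j *\<^sub>R evec j)"
  unfolding vec_eq_iff sum_evec_nth by (simp add: P_p)

lemma inner_p:
  assumes "u \<in> Poly_Mapping.keys f"
  shows "proj_real u \<bullet> p = (\<Sum>j\<in>UNIV. real (Poly_Mapping.lookup u j) * P j) - real d * P None"
  by (subst p_eq_sum) (rule inner_proj_real[OF assms])

lemma tangent_coordinate:
  assumes "in_torus z" "c \<noteq> 0" "\<And>j. pderiv_eval f j (hpt z) \<noteq> 0"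
  defines "x \<equiv> \<lambda>j. c * hpt z j"
  shows "log_deriv f j x \<noteq> 0"
    and "- \<nu> (pderiv_eval f (Some i) (hpt z) / pderiv_eval f None (hpt z)) =
      \<nu> (z i) - \<nu> (log_deriv f (Some i) x) + \<nu> (log_deriv f None x)"
proof -
  have hpt: "hpt z j \<noteq> 0" for j
    using assms(1) by (auto simp: hpt_def in_torus_def split: option.split)
  have eq: "log_deriv f j x = c ^ d * (hpt z j * pderiv_eval f j (hpt z))" for j
    unfolding x_def homogeneous_scale(2)[OF homogeneous] by (simp add: log_deriv_eq_pderiv)
  show "log_deriv f j x \<noteq> 0"
    using assms(2,3) hpt unfolding eq by simp
  have "\<nu> (log_deriv f j x) = \<nu> (c ^ d) + (\<nu> (hpt z j) + \<nu> (pderiv_eval f j (hpt z)))" for j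
    using assms(2,3) hpt by (simp add: eq val_mult)
  moreover have "\<nu> (hpt z None) = 0" "hpt z (Some i) = z i"
    by (simp_all add: hpt_def val_one)
  ultimately show "- \<nu> (pderiv_eval f (Some i) (hpt z) / pderiv_eval f None (hpt z)) =
      \<nu> (z i) - \<nu> (log_deriv f (Some i) x) + \<nu> (log_deriv f None x)"
    using assms(3) by (simp add: val_divide)
qed

text \<open>Rescaling affine torus points to lifts multiplies all logarithmic derivatives by the
  same factor, which cancels in the quotients; the factors x_j in these derivatives account for the
  summand \<open>- p\<close>.\<close>

lemma trop_tangent_iff:
  "trop_tangent \<nu> f p q \<longleftrightarrow> (\<exists>x. lifts x \<and> peval f x = 0 \<and> (\<forall>j. log_deriv f j x \<noteq> 0) \<and>
    q = - p - (\<Sum>j\<in>UNIV. \<nu> (log_deriv f j x) *\<^sub>R evec j))"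
proof
  assume "trop_tangent \<nu> f p q"
  then obtain z where z: "in_torus z" "peval f (hpt z) = 0" "\<And>j. pderiv_eval f j (hpt z) \<noteq> 0"
    "trop_pt \<nu> z = p"
    "q = (\<chi> i. - \<nu> (pderiv_eval f (Some i) (hpt z) / pderiv_eval f None (hpt z)))"
    unfolding trop_tangent_def by blast
  have hpt: "hpt z j \<noteq> 0" for j
    using z(1) by (auto simp: hpt_def in_torus_def split: option.split)
  have vz: "\<nu> (z i) = - p $ i" for i
    using z(4) by (metis minus_minus trop_pt_def vec_lambda_beta)
  have vhpt: "\<nu> (hpt z j) = P None - P j" for j
    by (cases j) (simp_all add: hpt_def vz P_p val_one)
  \<comment> \<open>Any maximal term would serve. Its valuation is \<open>d\<close> times
    \<open>P None\<close>, so a \<open>d\<close>-th root of its inverse is a scalar of the valuation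
    wanted.\<close>
  define t where "t = term_eval f (U None) (hpt z)"
  have U: "Poly_Mapping.lookup f (U None) \<noteq> 0"
    using U_keys by (simp add: in_keys_iff)
  have t: "t \<noteq> 0"
    using U hpt by (simp add: t_def term_eval_def)
  have "\<nu> t = \<nu> (Poly_Mapping.lookup f (U None)) +
      (\<Sum>j\<in>UNIV. real (Poly_Mapping.lookup (U None) j) * (P None - P j))"
    using hpt U unfolding t_def term_eval_def by (subst val_mult) (auto simp: val_prod val_power vhpt)
  also have "\<dots> = (\<Sum>j\<in>UNIV. real (Poly_Mapping.lookup (U None) j)) * P None"
    by (simp add: val_on right_diff_distrib sum_subtractf sum_distrib_right)
  also have "\<dots> = real d * P None"
    using sum_exponents[OF U_keys[of None]] by (metis of_nat_sum)
  finally have vt: "\<nu> t = real d * P None" .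
  obtain c where c: "c ^ d = inverse t"
    using nth_root[OF closed d_pos] by blast
  have c0: "c \<noteq> 0"
    using c t d_pos by (auto simp: zero_power)
  have "real d * \<nu> c = - real d * P None"
    using val_power[OF c0, of d] vt t by (simp add: c val_inverse)
  then have vc: "\<nu> c = - P None"
    using d_pos by (metis (no_types) mult_cancel_left mult_minus_left mult_minus_right of_nat_0_eq_iff less_irrefl)
  define x where "x = (\<lambda>j. c * hpt z j)"
  have "lifts x"
    using c0 hpt by (simp add: lifts_def x_def val_mult vc vhpt)
  moreover have "peval f x = 0"
    by (simp add: x_def homogeneous_scale(1)[OF homogeneous] z(2))
  moreover have "\<forall>j. log_deriv f j x \<noteq> 0"
    using tangent_coordinate(1)[OF z(1) c0 z(3), folded x_def] by blast
  moreover have "q = - p - (\<Sum>j\<in>UNIV. \<nu> (log_deriv f j x) *\<^sub>R evec j)"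
    unfolding vec_eq_iff z(5) using tangent_coordinate(2)[OF z(1) c0 z(3), folded x_def]
    by (simp add: sum_evec_nth vz del: sum_component)
  ultimately show "\<exists>x. lifts x \<and> peval f x = 0 \<and> (\<forall>j. log_deriv f j x \<noteq> 0) \<and>
    q = - p - (\<Sum>j\<in>UNIV. \<nu> (log_deriv f j x) *\<^sub>R evec j)"
    by blast
next
  assume "\<exists>x. lifts x \<and> peval f x = 0 \<and> (\<forall>j. log_deriv f j x \<noteq> 0) \<and>
    q = - p - (\<Sum>j\<in>UNIV. \<nu> (log_deriv f j x) *\<^sub>R evec j)"
  then obtain x where x: "lifts x" "peval f x = 0" "\<And>j. log_deriv f j x \<noteq> 0"
    "q = - p - (\<Sum>j\<in>UNIV. \<nu> (log_deriv f j x) *\<^sub>R evec j)"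
    by blast
  have x0: "x j \<noteq> 0" "\<nu> (x j) = - P j" for j
    using x(1) by (auto simp: lifts_def)
  define z where "z i = x (Some i) / x None" for i
  have hpt: "hpt z j = x j / x None" for j
    using x0 by (cases j) (simp_all add: hpt_def z_def)
  then have x_eq: "(\<lambda>j. x None * hpt z j) = x"
    using x0 by auto
  have torus: "in_torus z"
    using x0 by (simp add: in_torus_def z_def)
  have vz: "\<nu> (z i) = - p $ i" for i
    using x0 by (simp add: z_def val_divide P_p)
  have "x None ^ d * peval f (hpt z) = 0"
    using x(2) homogeneous_scale(1)[OF homogeneous, of "x None" "hpt z"] by (simp add: x_eq)
  then have root: "peval f (hpt z) = 0"
    using x0 by simp
  have pd: "pderiv_eval f j (hpt z) \<noteq> 0" for j
    using x(3)[of j] homogeneous_scale(2)[OF homogeneous, of j "x None" "hpt z"]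
    by (auto simp: x_eq log_deriv_eq_pderiv)
  have "trop_pt \<nu> z = p"
    by (simp add: trop_pt_def vec_eq_iff vz)
  moreover have "q = (\<chi> i. - \<nu> (pderiv_eval f (Some i) (hpt z) / pderiv_eval f None (hpt z)))"
    unfolding vec_eq_iff x(4) using tangent_coordinate(2)[OF torus x0(1)[of None] pd]
    by (simp add: sum_evec_nth vz x_eq del: sum_component)
  ultimately show "trop_tangent \<nu> f p q"
    unfolding trop_tangent_def using torus root pd by blast
qed

text \<open>Up to a shift independent of \<open>l\<close>, its pairing with
  \<open>proj_real (U l)\<close> is \<open>d\<close> for \<open>l = k\<close> and zero otherwise:
  walking backwards along it lowers only the term \<open>U k\<close>.\<close>

definition edge_dir :: "'n option \<Rightarrow> real^'n" where
  "edge_dir k = (\<Sum>j\<in>UNIV. real_of_int (D j k) *\<^sub>R evec j)"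

lemma max_terms_p: "max_terms \<nu> f p = range U"
proof -
  define h where "h u = \<nu> (Poly_Mapping.lookup f u) - (\<Sum>j\<in>UNIV. real (Poly_Mapping.lookup u j) * P j)" for u
  have eq: "- \<nu> (Poly_Mapping.lookup f u) + proj_real u \<bullet> p = - real d * P None - h u"
    if "u \<in> Poly_Mapping.keys f" for u
    using inner_p[OF that] by (simp add: h_def)
  have h0: "h (U k) = 0" for k
    by (simp add: h_def val_on)
  have hpos: "0 < h u" if "u \<in> Poly_Mapping.keys f" "u \<notin> range U" for u
    using val_off[OF that] delta_pos by (simp add: h_def)
  have "u \<in> max_terms \<nu> f p \<longleftrightarrow> u \<in> Poly_Mapping.keys f \<and> (\<forall>v\<in>Poly_Mapping.keys f. h u \<le> h v)" for u
    unfolding max_terms_def using eq by auto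
  moreover have "(u \<in> Poly_Mapping.keys f \<and> (\<forall>v\<in>Poly_Mapping.keys f. h u \<le> h v)) \<longleftrightarrow> u \<in> range U" for u
  proof
    assume u: "u \<in> Poly_Mapping.keys f \<and> (\<forall>v\<in>Poly_Mapping.keys f. h u \<le> h v)"
    then have "h u \<le> 0"
      using h0 U_keys by metis
    then show "u \<in> range U"
      using u hpos[of u] by force
  next
    assume "u \<in> range U"
    then have "h u = 0" "u \<in> Poly_Mapping.keys f"
      using h0 U_keys by auto
    moreover have "0 \<le> h v" if "v \<in> Poly_Mapping.keys f" for v
      using hpos[OF that] h0 by (cases "v \<in> range U") auto
    ultimately show "u \<in> Poly_Mapping.keys f \<and> (\<forall>v\<in>Poly_Mapping.keys f. h u \<le> h v)"
      by auto
  qed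
  ultimately show ?thesis
    by blast
qed

lemma inner_edge_dir:
  assumes "u \<in> Poly_Mapping.keys f"
  shows "proj_real u \<bullet> edge_dir k =
    real_of_int (\<Sum>j\<in>UNIV. int (Poly_Mapping.lookup u j) * D j k) - real d * real_of_int (D None k)"
  unfolding edge_dir_def inner_proj_real[OF assms] by simp

lemma max_terms_edge:
  obtains \<epsilon> where "0 < \<epsilon>" "max_terms \<nu> f (p - \<epsilon> *\<^sub>R edge_dir k) = U ` (UNIV - {k})"
proof -
  define h where "h u = \<nu> (Poly_Mapping.lookup f u) - (\<Sum>j\<in>UNIV. real (Poly_Mapping.lookup u j) * P j)" for u
  define b where "b u = real_of_int (\<Sum>j\<in>UNIV. int (Poly_Mapping.lookup u j) * D j k)" for u
  \<comment> \<open>Short enough that no term outside the simplex can make up the gap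
    \<open>\<delta>\<close>; the added 1 keeps the denominator positive.\<close>
  define \<epsilon> where "\<epsilon> = \<delta> / (1 + (\<Sum>u\<in>Poly_Mapping.keys f. \<bar>b u\<bar>))"
  have B: "0 \<le> (\<Sum>u\<in>Poly_Mapping.keys f. \<bar>b u\<bar>)"
    by (intro sum_nonneg) auto
  then have \<epsilon>: "0 < \<epsilon>"
    unfolding \<epsilon>_def using delta_pos by (intro divide_pos_pos) linarith+
  have small: "\<epsilon> * \<bar>b u\<bar> < \<delta>" if "u \<in> Poly_Mapping.keys f" for u
  proof -
    have "\<bar>b u\<bar> < 1 + (\<Sum>u\<in>Poly_Mapping.keys f. \<bar>b u\<bar>)"
      using member_le_sum[OF that, of "\<lambda>u. \<bar>b u\<bar>"] by simp
    then have "\<epsilon> * \<bar>b u\<bar> < \<epsilon> * (1 + (\<Sum>u\<in>Poly_Mapping.keys f. \<bar>b u\<bar>))"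
      using \<epsilon> by (rule mult_strict_left_mono)
    then show ?thesis
      using B by (simp add: \<epsilon>_def)
  qed
  define C where "C = - real d * P None + \<epsilon> * (real d * real_of_int (D None k))"
  have eq: "- \<nu> (Poly_Mapping.lookup f u) + proj_real u \<bullet> (p - \<epsilon> *\<^sub>R edge_dir k) = C - (h u + \<epsilon> * b u)"
    if "u \<in> Poly_Mapping.keys f" for u
    unfolding inner_diff_right inner_scaleR_right inner_p[OF that] inner_edge_dir[OF that, of k]
    by (simp add: h_def b_def C_def algebra_simps)
  have max: "u \<in> max_terms \<nu> f (p - \<epsilon> *\<^sub>R edge_dir k) \<longleftrightarrow>
      u \<in> Poly_Mapping.keys f \<and> (\<forall>v\<in>Poly_Mapping.keys f. h u + \<epsilon> * b u \<le> h v + \<epsilon> * b v)" for u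
  proof -
    have "- \<nu> (Poly_Mapping.lookup f v) + proj_real v \<bullet> (p - \<epsilon> *\<^sub>R edge_dir k)
        \<le> - \<nu> (Poly_Mapping.lookup f u) + proj_real u \<bullet> (p - \<epsilon> *\<^sub>R edge_dir k) \<longleftrightarrow>
        h u + \<epsilon> * b u \<le> h v + \<epsilon> * b v"
      if "u \<in> Poly_Mapping.keys f" "v \<in> Poly_Mapping.keys f" for v
      unfolding eq[OF that(1)] eq[OF that(2)] by linarith
    then show ?thesis
      unfolding max_terms_def by blast
  qed
  have on: "h (U l) + \<epsilon> * b (U l) = (if l = k then \<epsilon> * real d else 0)" for l
    by (simp only: h_def b_def UD val_on) simp
  have off: "0 < h u + \<epsilon> * b u" if "u \<in> Poly_Mapping.keys f" "u \<notin> range U" for u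
  proof -
    have "- (\<epsilon> * \<bar>b u\<bar>) \<le> \<epsilon> * b u"
      using \<epsilon> by (metis abs_ge_minus_self abs_mult abs_of_pos minus_le_iff)
    then show ?thesis
      using small[OF that(1)] val_off[OF that] by (simp add: h_def)
  qed
  obtain l where l: "l \<noteq> k"
    by (cases k) auto
  have "u \<in> max_terms \<nu> f (p - \<epsilon> *\<^sub>R edge_dir k) \<longleftrightarrow> u \<in> U ` (UNIV - {k})" for u
  proof
    assume "u \<in> max_terms \<nu> f (p - \<epsilon> *\<^sub>R edge_dir k)"
    then have u: "u \<in> Poly_Mapping.keys f" "h u + \<epsilon> * b u \<le> 0"
      unfolding max using on[of l] l U_keys[of l] by fastforce+
    then obtain m where m: "u = U m"
      using off by fastforce
    then have "m \<noteq> k"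
      using u(2) on[of m] mult_pos_pos[OF \<epsilon>, of "real d"] d_pos by auto
    then show "u \<in> U ` (UNIV - {k})"
      using m by blast
  next
    assume "u \<in> U ` (UNIV - {k})"
    then obtain m where "u = U m" "m \<noteq> k"
      by blast
    then have "u \<in> Poly_Mapping.keys f" "h u + \<epsilon> * b u = 0"
      using on[of m] U_keys[of m] by simp_all
    moreover have "0 \<le> h v + \<epsilon> * b v" if "v \<in> Poly_Mapping.keys f" for v
    proof (cases "v \<in> range U")
      case True
      then obtain m where "v = U m"
        by blast
      then show ?thesis
        using on[of m] \<epsilon> by simp
    qed (use off[OF that] in auto)
    ultimately show "u \<in> max_terms \<nu> f (p - \<epsilon> *\<^sub>R edge_dir k)"
      unfolding max by auto
  qed
  then show ?thesis
    using that[OF \<epsilon>] by blast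
qed

text \<open>The vertex condition makes the affine hull full-dimensional, and n+1 points can span it
  only if they are distinct and affinely independent.\<close>

lemma simplex_independent:
  "inj (proj_real \<circ> U)" "\<not> affine_dependent (range (proj_real \<circ> U))"
proof -
  define A where "A = range (proj_real \<circ> U)"
  have dim: "aff_dim A = int CARD('n)"
    using vertex by (simp add: trop_vertex_def max_terms_p A_def image_comp)
  have "card A \<le> CARD('n option)"
    unfolding A_def by (rule card_image_le) simp
  moreover have "aff_dim A \<le> int (card A) - 1"
    unfolding A_def by (intro aff_dim_le_card) simp
  ultimately have card: "card A = CARD('n option)"
    using dim by simp
  then show "inj (proj_real \<circ> U)"
    unfolding A_def by (intro eq_card_imp_inj_on) auto
  show "\<not> affine_dependent (range (proj_real \<circ> U))"
    using card dim unfolding affine_independent_iff_card A_def by simp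
qed

lemma aff_dim_face: "aff_dim ((proj_real \<circ> U) ` K) = int (card K) - 1"
proof -
  have "\<not> affine_dependent ((proj_real \<circ> U) ` K)"
    using simplex_independent(2) by (rule affine_independent_subset) auto
  moreover have "card ((proj_real \<circ> U) ` K) = card K"
    using simplex_independent(1) by (meson card_image inj_on_subset subset_UNIV)
  ultimately show ?thesis
    by (simp add: affine_independent_iff_card)
qed

lemma sum_evec_0: "(\<Sum>j\<in>UNIV. c *\<^sub>R evec j) = (0 :: real^'n)"
  unfolding vec_eq_iff sum_evec_nth by simp

text \<open>If column \<open>k\<close> is constant off \<open>J\<close>, the direction of the edge
  dual to the facet without \<open>U k\<close> lies in the span of the \<open>evec j\<close> with
  \<open>j\<close> in \<open>J\<close>.\<close>

lemma admissible_imp_splits: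
  assumes "admissible_J \<nu> f p J"
  shows "splits J"
proof (rule ccontr)
  assume "\<not> splits J"
  then obtain k where k: "\<And>i j. i \<notin> J \<Longrightarrow> j \<notin> J \<Longrightarrow> D i k = D j k"
    unfolding splits_def by blast
  have "\<exists>\<kappa>. \<forall>j. j \<notin> J \<longrightarrow> D j k = \<kappa>"
  proof (cases "J = UNIV")
    case False
    then obtain i where "i \<notin> J"
      by blast
    then show ?thesis
      using k by blast
  qed auto
  then obtain \<kappa> where \<kappa>: "\<And>j. j \<notin> J \<Longrightarrow> D j k = \<kappa>"
    by blast
  \<comment> \<open>The vectors \<open>evec j\<close> sum to zero, so the constant may be subtracted
    from every coefficient.\<close>
  have "edge_dir k = (\<Sum>j\<in>UNIV. (real_of_int (D j k) - real_of_int \<kappa>) *\<^sub>R evec j)"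
    unfolding scaleR_left_diff_distrib sum_subtractf sum_evec_0 edge_dir_def by simp
  also have "\<dots> \<in> span (evec ` J)"
  proof (rule span_sum)
    fix j
    show "(real_of_int (D j k) - real_of_int \<kappa>) *\<^sub>R evec j \<in> span (evec ` J)"
      using \<kappa>[of j] by (cases "j \<in> J") (auto intro: span_scale span_base simp: span_zero)
  qed
  finally have in_span: "edge_dir k \<in> span (evec ` J)" .
  obtain \<epsilon> where \<epsilon>: "0 < \<epsilon>" "max_terms \<nu> f (p - \<epsilon> *\<^sub>R edge_dir k) = U ` (UNIV - {k})"
    using max_terms_edge by blast
  define w where "w = p - \<epsilon> *\<^sub>R edge_dir k"
  define E where "E = dual_cell \<nu> f (max_terms \<nu> f w)"
  have "proj_real ` max_terms \<nu> f w = (proj_real \<circ> U) ` (UNIV - {k})"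
    unfolding w_def \<epsilon>(2) by (simp add: image_comp)
  then have "aff_dim (proj_real ` max_terms \<nu> f w) = int (card (UNIV - {k})) - 1"
    using aff_dim_face by simp
  then have "aff_dim (proj_real ` max_terms \<nu> f w) = int CARD('n) - 1"
    by (simp add: card_Diff_singleton)
  then have "E \<in> trop_edges \<nu> f"
    unfolding trop_edges_def E_def by blast
  moreover have "p \<in> E" "w \<in> E"
    unfolding E_def dual_cell_def mem_Collect_eq max_terms_p w_def \<epsilon>(2) by auto
  ultimately have disj: "diff_span E \<inter> span (evec ` J) = {0}"
    using assms unfolding admissible_J_def by blast
  have "p - w \<in> diff_span E"
    unfolding diff_span_def using \<open>p \<in> E\<close> \<open>w \<in> E\<close> by (intro span_base) blast
  then have "(1 / \<epsilon>) *\<^sub>R (p - w) \<in> diff_span E"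
    unfolding diff_span_def by (rule span_scale)
  then have "edge_dir k \<in> diff_span E"
    using \<epsilon>(1) by (simp add: w_def)
  then have zero: "edge_dir k = 0"
    using in_span disj by blast
  \<comment> \<open>The direction is nonzero because its pairings with \<open>U k\<close> and
    \<open>U l\<close> differ by \<open>d\<close>.\<close>
  obtain l where "l \<noteq> k"
    by (cases k) auto
  then show False
    using inner_edge_dir[OF U_keys, of l k] inner_edge_dir[OF U_keys, of k k] d_pos
    unfolding zero UD by simp
qed

text \<open>An edge through \<open>p\<close> omits exactly one vertex \<open>U k\<close>. For a
  vector along it with coefficients \<open>v\<close>, the pairings \<open>g l\<close> agree for all
  \<open>l\<close> other than \<open>k\<close>, so inverting the exponent matrix shows that
  \<open>v\<close> is affine in column \<open>k\<close> of \<open>D\<close>. Two different entries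
  of that column off \<open>J\<close>, where \<open>v\<close> vanishes, force
  \<open>v = 0\<close>.\<close>

lemma splits_imp_admissible:
  assumes "splits J"
  shows "admissible_J \<nu> f p J"
  unfolding admissible_J_def
proof (intro ballI impI)
  fix E assume "E \<in> trop_edges \<nu> f" and pE: "p \<in> E"
  then obtain w where E: "E = dual_cell \<nu> f (max_terms \<nu> f w)"
    and dim: "aff_dim (proj_real ` max_terms \<nu> f w) = int CARD('n) - 1"
    unfolding trop_edges_def by blast
  have "max_terms \<nu> f w \<subseteq> range U"
    using pE unfolding E dual_cell_def mem_Collect_eq max_terms_p .
  then obtain K where K: "max_terms \<nu> f w = U ` K"
    by (metis subset_image_iff)
  have "int (card K) = int CARD('n)"
    using dim aff_dim_face[of K] unfolding K image_comp by simp
  then have card: "card K = CARD('n)"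
    by simp
  then have "K \<noteq> UNIV"
    by auto
  then obtain k where "k \<notin> K"
    by blast
  then have "K = UNIV - {k}"
    using card by (intro card_subset_eq) (auto simp: card_Diff_singleton)
  have orth: "(proj_real (U l) - proj_real (U m)) \<bullet> x = 0"
    if "x \<in> diff_span E" "l \<in> K" "m \<in> K" for x l m
  proof -
    define y where "y = proj_real (U l) - proj_real (U m)"
    have "y \<bullet> a = \<nu> (Poly_Mapping.lookup f (U l)) - \<nu> (Poly_Mapping.lookup f (U m))" if "a \<in> E" for a
    proof -
      have "U l \<in> max_terms \<nu> f a" "U m \<in> max_terms \<nu> f a"
        using that \<open>l \<in> K\<close> \<open>m \<in> K\<close> unfolding E dual_cell_def K by auto
      then show ?thesis
        unfolding max_terms_def y_def inner_diff_left using U_keys by (smt (verit) mem_Collect_eq)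
    qed
    then have "{a - b | a b. a \<in> E \<and> b \<in> E} \<subseteq> {x. y \<bullet> x = 0}"
      by (auto simp: inner_diff_right)
    then have "diff_span E \<subseteq> {x. y \<bullet> x = 0}"
      unfolding diff_span_def by (rule span_minimal) (rule subspace_hyperplane)
    then show ?thesis
      using that(1) y_def by blast
  qed
  have "x = 0" if x: "x \<in> diff_span E" "x \<in> span (evec ` J)" for x
  proof -
    obtain v where v: "\<And>j. j \<notin> J \<Longrightarrow> v j = 0" "x = (\<Sum>j\<in>UNIV. v j *\<^sub>R evec j)"
      using span_evec_image[OF x(2)] by blast
    define g where "g l = (\<Sum>j\<in>UNIV. real (Poly_Mapping.lookup (U l) j) * v j)" for l
    obtain m where "m \<noteq> k"
      by (cases k) auto
    have g: "g l = g m" if "l \<noteq> k" for l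
      using orth[OF x(1), of l m] that \<open>m \<noteq> k\<close> unfolding \<open>K = UNIV - {k}\<close>
      by (simp add: inner_diff_left v(2) inner_proj_real U_keys g_def del: sum_component)
    \<comment> \<open>The coefficient of \<open>g m\<close> is a row sum of \<open>D\<close>, which
      is 1.\<close>
    have "real d * v j = g m + (g k - g m) * real_of_int (D j k)" for j
    proof -
      have "real d * v j = (\<Sum>i\<in>UNIV. real_of_int (\<Sum>l\<in>UNIV. D j l * int (Poly_Mapping.lookup (U l) i)) * v i)"
        unfolding DU by (simp only: sum_of_int_delta of_int_of_nat_eq)
      also have "\<dots> = (\<Sum>l\<in>UNIV. real_of_int (D j l) * g l)"
        unfolding g_def of_int_sum sum_distrib_left sum_distrib_right
        by (subst sum.swap) (simp add: mult_ac)
      also have "\<dots> = (\<Sum>l\<in>UNIV. real_of_int (D j l) * g m + (if l = k then (g k - g m) * real_of_int (D j k) else 0))"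
        using g by (intro sum.cong) (auto simp: algebra_simps)
      also have "\<dots> = real_of_int (\<Sum>l\<in>UNIV. D j l) * g m + (g k - g m) * real_of_int (D j k)"
        by (simp add: sum.distrib sum_distrib_right)
      finally show ?thesis
        by (simp add: sum_D)
    qed
    moreover obtain i j where ij: "i \<notin> J" "j \<notin> J" "D i k \<noteq> D j k"
      using assms unfolding splits_def by blast
    ultimately have "g m + (g k - g m) * real_of_int (D i k) = 0"
      "g m + (g k - g m) * real_of_int (D j k) = 0"
      using v(1) by (metis mult_zero_right)+
    then have "(g k - g m) * (real_of_int (D i k) - real_of_int (D j k)) = 0"
      by (simp add: algebra_simps)
    then have "g k - g m = 0"
      using ij(3) by simp
    with \<open>g m + (g k - g m) * real_of_int (D i k) = 0\<close> have "g k = 0" "g m = 0"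
      by auto
    then have "v j = 0" for j
      using \<open>\<And>j. real d * v j = g m + (g k - g m) * real_of_int (D j k)\<close>[of j] d_pos by simp
    then show "x = 0"
      by (simp add: v(2))
  qed
  moreover have "0 \<in> diff_span E" "0 \<in> span (evec ` J)"
    by (simp_all add: diff_span_def span_zero)
  ultimately show "diff_span E \<inter> span (evec ` J) = {0}"
    by blast
qed

lemma admissible_iff_splits: "admissible_J \<nu> f p J \<longleftrightarrow> splits J"
  using admissible_imp_splits splits_imp_admissible by blast

section \<open>The closure of the set of tangents as a union of cones\<close>

definition tangent_cone :: "'n option set \<Rightarrow> (real^'n) set" where
  "tangent_cone J = {- p - (\<Sum>i\<in>J. t i *\<^sub>R evec i) | t. \<forall>i\<in>J. t i \<ge> 0}"

lemma splits_extends: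
  assumes "splits J"
  obtains J' where "J \<subseteq> J'" "J' \<in> Jset \<nu> f p"
proof -
  have "finite {J. splits J}"
    by simp
  from finite_has_maximal2[OF this, of J] assms
  obtain J' where J': "J \<subseteq> J'" "splits J'" "\<And>A. splits A \<Longrightarrow> J' \<subseteq> A \<Longrightarrow> J' = A"
    by auto
  have "\<not> splits A" if "J' \<subset> A" for A
    using J'(3)[of A] that by blast
  then have "J' \<in> Jset \<nu> f p"
    unfolding Jset_def mem_Collect_eq admissible_iff_splits using J'(2) by simp
  then show ?thesis
    by (rule that[OF J'(1)])
qed

text \<open>The indices whose logarithmic derivative has positive valuation satisfy
  \<open>splits\<close> by \<open>column_not_constant\<close>; enlarging them to a maximal set adds
  only zero coefficients.\<close>

lemma trop_tangent_in_tangent_cone: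
  assumes "trop_tangent \<nu> f p q"
  shows "\<exists>J\<in>Jset \<nu> f p. q \<in> tangent_cone J"
proof -
  obtain x where x: "lifts x" "peval f x = 0" "\<And>j. log_deriv f j x \<noteq> 0"
    "q = - p - (\<Sum>j\<in>UNIV. \<nu> (log_deriv f j x) *\<^sub>R evec j)"
    using assms unfolding trop_tangent_iff by blast
  have nonneg: "0 \<le> \<nu> (log_deriv f j x)" for j
    using log_deriv_vge_0[OF x(1), of j] x(3) by (simp add: vge_def)
  define Z where "Z = {j. 0 < \<nu> (log_deriv f j x)}"
  have "splits Z"
    unfolding splits_def Z_def using column_not_constant[OF x(1,2)] by (simp add: not_less)
  then obtain J where J: "Z \<subseteq> J" "J \<in> Jset \<nu> f p"
    by (rule splits_extends)
  have "\<nu> (log_deriv f j x) = 0" if "j \<notin> J" for j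
    using that J(1) nonneg[of j] by (force simp: Z_def)
  then have "(\<Sum>j\<in>UNIV. \<nu> (log_deriv f j x) *\<^sub>R evec j) = (\<Sum>j\<in>J. \<nu> (log_deriv f j x) *\<^sub>R evec j)"
    by (intro sum.mono_neutral_right) auto
  then have "q \<in> tangent_cone J"
    unfolding tangent_cone_def mem_Collect_eq x(4)
    using nonneg by (intro exI[of _ "\<lambda>j. \<nu> (log_deriv f j x)"]) simp
  then show ?thesis
    using J(2) by blast
qed

text \<open>A finitely generated convex cone is closed, and the set is a reflected translate of
  one.\<close>

lemma closed_tangent_cone: "closed (tangent_cone J)"
proof -
  define C where "C = {\<Sum>i\<in>J. t i *\<^sub>R (evec i :: real^'n) | t. \<forall>i\<in>J. t i \<ge> 0}"
  have "convex_cone hull (evec ` J) = C"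
  proof (rule hull_unique)
    show "evec ` J \<subseteq> C"
    proof
      fix x assume "x \<in> (evec ` J :: (real^'n) set)"
      then obtain j where j: "j \<in> J" "x = evec j"
        by blast
      then have "x = (\<Sum>i\<in>J. (if i = j then 1 else 0) *\<^sub>R evec i)"
        by (simp add: if_distrib[of "\<lambda>x. x *\<^sub>R _"] cong: if_cong)
      then show "x \<in> C"
        unfolding C_def by fastforce
    qed
    show "convex_cone C"
      unfolding convex_cone_iff
    proof (intro conjI ballI allI impI)
      show "0 \<in> C"
        unfolding C_def by (auto intro: exI[of _ "\<lambda>_. 0"])
    next
      fix x y assume "x \<in> C" "y \<in> C"
      then obtain s t where "\<forall>i\<in>J. s i \<ge> 0" "x = (\<Sum>i\<in>J. s i *\<^sub>R evec i)"
        "\<forall>i\<in>J. t i \<ge> 0" "y = (\<Sum>i\<in>J. t i *\<^sub>R evec i)"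
        unfolding C_def by blast
      then show "x + y \<in> C"
        unfolding C_def by (auto intro!: exI[of _ "\<lambda>i. s i + t i"] simp: scaleR_add_left sum.distrib)
    next
      fix x and c :: real assume "x \<in> C" "0 \<le> c"
      then obtain t where "\<forall>i\<in>J. t i \<ge> 0" "x = (\<Sum>i\<in>J. t i *\<^sub>R evec i)"
        unfolding C_def by blast
      then show "c *\<^sub>R x \<in> C"
        unfolding C_def using \<open>0 \<le> c\<close> by (auto intro!: exI[of _ "\<lambda>i. c * t i"] simp: scaleR_sum_right)
    qed
    fix S :: "(real^'n) set" assume S: "evec ` J \<subseteq> S" "convex_cone S"
    have "(\<Sum>i\<in>I. t i *\<^sub>R evec i) \<in> S" if "I \<subseteq> J" "\<forall>i\<in>J. t i \<ge> 0" for t I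
      using finite[of I] that(1)
      by (induction I rule: finite_induct)
        (use S that(2) in \<open>auto simp: convex_cone_contains_0 intro!: convex_cone_add convex_cone_scaleR\<close>)
    then show "C \<subseteq> S"
      unfolding C_def by blast
  qed
  then have "closed C"
    using closed_convex_cone_hull[of "evec ` J :: (real^'n) set"] by simp
  moreover have "tangent_cone J = (+) (- p) ` uminus ` C"
    unfolding tangent_cone_def C_def by (auto simp: image_iff)
  ultimately show ?thesis
    by (metis closed_negations closed_translation)
qed

text \<open>The prescribed valuations must be positive and lie in the value group, so the
  coefficients \<open>t i\<close>, some of which may be zero, are approached strictly from
  above.\<close>

lemma tangent_cone_in_closure:
  assumes J: "J \<in> Jset \<nu> f p" and q: "q \<in> tangent_cone J"
  shows "q \<in> closure {q. trop_tangent \<nu> f p q}"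
proof -
  obtain t where t: "\<And>i. i \<in> J \<Longrightarrow> t i \<ge> 0" "q = - p - (\<Sum>i\<in>J. t i *\<^sub>R evec i)"
    using q unfolding tangent_cone_def by blast
  have max: "splits J" "\<And>A. splits A \<Longrightarrow> J \<subseteq> A \<Longrightarrow> A = J"
    using J unfolding Jset_def admissible_iff_splits by blast+
  obtain l where l: "generic J l"
    using splits_imp_generic[OF max(1)] by blast
  \<comment> \<open>The zero set contains \<open>J\<close> and satisfies \<open>splits\<close>, so
    maximality leaves only equality.\<close>
  have "{j. l j = 0} = J"
    using max(2)[OF generic_imp_splits[OF l]] l by (auto simp: generic_def)
  then have nz: "l j \<noteq> 0" if "j \<notin> J" for j
    using that by blast
  have approx: "\<exists>s. (\<forall>i\<in>J. t i < s i \<and> s i < t i + e) \<and> trop_tangent \<nu> f p (- p - (\<Sum>i\<in>J. s i *\<^sub>R evec i))"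
    if "0 < e" for e
  proof -
    have "\<exists>x. x \<noteq> 0 \<and> t i < \<nu> x \<and> \<nu> x < t i + e" if "i \<in> J" for i
      using val_dense[OF closed t(1)[OF that], of "t i + e"] \<open>0 < e\<close> by (metis less_add_same_cancel1)
    then obtain \<epsilon> where \<epsilon>: "\<And>i. i \<in> J \<Longrightarrow> \<epsilon> i \<noteq> 0 \<and> t i < \<nu> (\<epsilon> i) \<and> \<nu> (\<epsilon> i) < t i + e"
      by metis
    have pos: "\<epsilon> i \<noteq> 0 \<and> 0 < \<nu> (\<epsilon> i)" if "i \<in> J" for i
      using \<epsilon>[OF that] t(1)[OF that] by auto
    have "\<exists>z. lifts z \<and> peval f z = 0 \<and> (\<forall>j. log_deriv f j z \<noteq> 0) \<and>
        (\<forall>j. \<nu> (log_deriv f j z) = (if j \<in> J then \<nu> (\<epsilon> j) else 0))"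
      by (rule realize_valuations[of J l \<epsilon>, OF l nz pos]) blast+
    then obtain z where z: "lifts z" "peval f z = 0" "\<And>j. log_deriv f j z \<noteq> 0"
      "\<And>j. \<nu> (log_deriv f j z) = (if j \<in> J then \<nu> (\<epsilon> j) else 0)"
      by blast
    have "trop_tangent \<nu> f p (- p - (\<Sum>j\<in>J. \<nu> (\<epsilon> j) *\<^sub>R evec j))"
      unfolding trop_tangent_iff sum_evec_subset[of _ J] using z by (intro exI[of _ z]) simp
    then show ?thesis
      using \<epsilon> by (intro exI[of _ "\<lambda>i. \<nu> (\<epsilon> i)"]) auto
  qed
  show ?thesis
    unfolding closure_approachable
  proof (intro allI impI)
    fix e :: real assume "0 < e"
    define B where "B = 1 + (\<Sum>i\<in>J. norm (evec i :: real^'n))"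
    have B: "0 < B"
      unfolding B_def by (intro add_pos_nonneg sum_nonneg) auto
    obtain s where s: "\<And>i. i \<in> J \<Longrightarrow> t i < s i \<and> s i < t i + e / B"
      "trop_tangent \<nu> f p (- p - (\<Sum>i\<in>J. s i *\<^sub>R evec i))"
      using approx[OF divide_pos_pos[OF \<open>0 < e\<close> B]] by blast
    have "dist (- p - (\<Sum>i\<in>J. s i *\<^sub>R evec i)) q = norm (\<Sum>i\<in>J. (t i - s i) *\<^sub>R (evec i :: real^'n))"
      by (simp add: dist_norm t(2) scaleR_left_diff_distrib sum_subtractf)
    also have "\<dots> \<le> (\<Sum>i\<in>J. norm ((t i - s i) *\<^sub>R (evec i :: real^'n)))"
      by (rule norm_sum)
    also have "\<dots> \<le> (\<Sum>i\<in>J. e / B * norm (evec i :: real^'n))"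
    proof (rule sum_mono)
      fix i assume "i \<in> J"
      then have "\<bar>t i - s i\<bar> \<le> e / B"
        using s(1)[of i] by linarith
      then show "norm ((t i - s i) *\<^sub>R (evec i :: real^'n)) \<le> e / B * norm (evec i :: real^'n)"
        unfolding norm_scaleR by (rule mult_right_mono) simp
    qed
    also have "\<dots> = e / B * (B - 1)"
      by (simp add: B_def sum_distrib_left)
    also have "\<dots> < e"
      using B \<open>0 < e\<close> by (simp add: field_simps)
    finally show "\<exists>y\<in>{q. trop_tangent \<nu> f p q}. dist y q < e"
      using s(2) by blast
  qed
qed

lemma closure_tangents:
  "closure {q. trop_tangent \<nu> f p q} = (\<Union>J\<in>Jset \<nu> f p. tangent_cone J)"
proof (rule antisym)
  have "closed (\<Union>J\<in>Jset \<nu> f p. tangent_cone J)"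
    by (intro closed_UN closed_tangent_cone ballI) simp
  then show "closure {q. trop_tangent \<nu> f p q} \<subseteq> (\<Union>J\<in>Jset \<nu> f p. tangent_cone J)"
    using trop_tangent_in_tangent_cone by (intro closure_minimal) auto
  show "(\<Union>J\<in>Jset \<nu> f p. tangent_cone J) \<subseteq> closure {q. trop_tangent \<nu> f p q}"
    using tangent_cone_in_closure by blast
qed

end

section \<open>Coordinates adapted to a smooth vertex\<close>

lemma scaled_inverse_of_basis:
  fixes U :: "'n::finite option \<Rightarrow> 'n option \<Rightarrow>\<^sub>0 nat"
  assumes row: "\<And>k. (\<Sum>j\<in>UNIV. Poly_Mapping.lookup (U k) j) = d"
    and basis: "\<And>i. \<exists>\<alpha> :: 'n option \<Rightarrow> int. \<forall>j. (\<Sum>k\<in>UNIV. \<alpha> k * (int (Poly_Mapping.lookup (U k) (Some j))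
      - int (Poly_Mapping.lookup (U m) (Some j)))) = (if i = j then 1 else 0)"
  shows "\<exists>D. \<forall>i j. (\<Sum>k\<in>UNIV. D i k * int (Poly_Mapping.lookup (U k) j)) = (if i = j then int d else 0)"
proof -
  define M where "M k j = int (Poly_Mapping.lookup (U k) j)" for k j
  have M_None: "M k None = int d - (\<Sum>i\<in>UNIV. M k (Some i))" for k
  proof -
    have "(\<Sum>j\<in>UNIV. M k j) = int d"
      unfolding M_def of_nat_sum[symmetric] row ..
    then show ?thesis
      by (simp add: sum_UNIV_option)
  qed
  obtain \<alpha> :: "'n \<Rightarrow> 'n option \<Rightarrow> int"
    where \<alpha>: "\<And>i j. (\<Sum>k\<in>UNIV. \<alpha> i k * (M k (Some j) - M m (Some j))) = (if i = j then 1 else 0)"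
    using basis unfolding M_def by metis
  \<comment> \<open>Changing the coefficient at \<open>m\<close>, which is multiplied by a zero
    difference, makes the coefficients sum to zero. On homogeneous exponents the combination is then
    e_i - e_0.\<close>
  define \<beta> where "\<beta> i k = \<alpha> i k - (if k = m then \<Sum>l\<in>UNIV. \<alpha> i l else 0)" for i k
  have \<beta>_sum: "(\<Sum>k\<in>UNIV. \<beta> i k) = 0" for i
    by (simp add: \<beta>_def sum_subtractf)
  have \<beta>_Some: "(\<Sum>k\<in>UNIV. \<beta> i k * M k (Some j)) = (if i = j then 1 else 0)" for i j
  proof -
    have "(\<Sum>k\<in>UNIV. (if k = m then \<Sum>l\<in>UNIV. \<alpha> i l else 0) * M k (Some j)) = (\<Sum>l\<in>UNIV. \<alpha> i l) * M m (Some j)"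
      using sum_of_int_delta(2)[of m "\<Sum>l\<in>UNIV. \<alpha> i l" "\<lambda>k. M k (Some j)"] by simp
    then show ?thesis
      using \<alpha>[of i j] by (simp add: \<beta>_def left_diff_distrib right_diff_distrib sum_subtractf sum_distrib_right)
  qed
  have \<beta>_None: "(\<Sum>k\<in>UNIV. \<beta> i k * M k None) = - 1" for i
  proof -
    have "(\<Sum>k\<in>UNIV. \<beta> i k * M k None) =
        (\<Sum>k\<in>UNIV. \<beta> i k) * int d - (\<Sum>j\<in>UNIV. \<Sum>k\<in>UNIV. \<beta> i k * M k (Some j))"
      unfolding M_None right_diff_distrib sum_subtractf sum_distrib_left sum_distrib_right
      by (subst sum.swap) simp
    then show ?thesis
      by (simp add: \<beta>_sum \<beta>_Some)
  qed
  \<comment> \<open>Removing the affine part of \<open>U m\<close> by means of the vectors e_i - e_0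
    leaves \<open>d\<close> times e_0; adding \<open>d\<close> times \<open>\<beta>\<close> then
    yields \<open>d\<close> times each e_i.\<close>
  define c where "c k = (if k = m then 1 else 0) - (\<Sum>i\<in>UNIV. M m (Some i) * \<beta> i k)" for k
  have c_sum: "(\<Sum>k\<in>UNIV. c k * M k j) = M m j - (\<Sum>i\<in>UNIV. M m (Some i) * (\<Sum>k\<in>UNIV. \<beta> i k * M k j))" for j
  proof -
    have "(\<Sum>k\<in>UNIV. (if k = m then 1 else 0) * M k j) = M m j"
      using sum_of_int_delta(2)[of m 1 "\<lambda>k. M k j"] by simp
    moreover have "(\<Sum>k\<in>UNIV. (\<Sum>i\<in>UNIV. M m (Some i) * \<beta> i k) * M k j) =
        (\<Sum>i\<in>UNIV. M m (Some i) * (\<Sum>k\<in>UNIV. \<beta> i k * M k j))"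
      unfolding sum_distrib_left sum_distrib_right by (subst sum.swap) (simp add: mult.assoc)
    ultimately show ?thesis
      by (simp add: c_def left_diff_distrib sum_subtractf)
  qed
  have c_Some: "(\<Sum>k\<in>UNIV. c k * M k (Some j)) = 0" for j
    unfolding c_sum \<beta>_Some by (simp add: if_distrib[of "\<lambda>x. _ * x"] cong: if_cong)
  have c_None: "(\<Sum>k\<in>UNIV. c k * M k None) = int d"
    unfolding c_sum \<beta>_None using M_None[of m] by (simp add: sum_negf)
  define D where "D i k = (case i of None \<Rightarrow> c k | Some i \<Rightarrow> int d * \<beta> i k + c k)" for i k
  have "(\<Sum>k\<in>UNIV. D i k * M k j) = (if i = j then int d else 0)" for i j
  proof (cases i)
    case None
    then show ?thesis
      by (cases j) (simp_all add: D_def c_Some c_None)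
  next
    case (Some l)
    have "(\<Sum>k\<in>UNIV. D i k * M k j) = int d * (\<Sum>k\<in>UNIV. \<beta> l k * M k j) + (\<Sum>k\<in>UNIV. c k * M k j)"
      by (simp add: D_def Some distrib_right sum.distrib sum_distrib_left mult.assoc)
    then show ?thesis
      by (cases j) (auto simp: Some \<beta>_Some \<beta>_None c_Some c_None)
  qed
  then show ?thesis
    unfolding M_def by blast
qed

lemma scaled_inverse_commutes:
  fixes D M :: "'i::finite \<Rightarrow> 'i \<Rightarrow> int"
  assumes "0 < d" "\<And>i j. (\<Sum>k\<in>UNIV. D i k * M k j) = (if i = j then d else 0)"
  shows "(\<Sum>j\<in>UNIV. M k j * D j l) = (if k = l then d else 0)"
proof -
  define A where "A = (\<chi> i k. real_of_int (D i k) / real_of_int d)"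
  define B where "B = (\<chi> k j. real_of_int (M k j))"
  have "(A ** B) $ i $ j = mat 1 $ i $ j" for i j
  proof -
    have "(A ** B) $ i $ j = real_of_int (\<Sum>k\<in>UNIV. D i k * M k j) / real_of_int d"
      by (simp add: A_def B_def matrix_matrix_mult_def sum_divide_distrib)
    also have "\<dots> = mat 1 $ i $ j"
      unfolding assms(2) using assms(1) by (simp add: mat_def)
    finally show ?thesis .
  qed
  then have "A ** B = mat 1"
    by (simp add: vec_eq_iff)
  then have "B ** A = mat 1"
    by (simp add: matrix_left_right_inverse)
  then have "(B ** A) $ k $ l = mat 1 $ k $ l"
    by simp
  moreover have "(B ** A) $ k $ l = real_of_int (\<Sum>j\<in>UNIV. M k j * D j l) / real_of_int d"
    by (simp add: A_def B_def matrix_matrix_mult_def sum_divide_distrib)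
  ultimately have "real_of_int (\<Sum>j\<in>UNIV. M k j * D j l) = real_of_int (if k = l then d else 0)"
    using assms(1) by (simp add: mat_def divide_simps split: if_splits)
  then show ?thesis
    by (simp only: of_int_eq_iff)
qed

text \<open>Full dimension requires n+1 maximal terms, so the unimodular simplex containing them has
  no further ones.\<close>

lemma smooth_vertex_simplex:
  fixes p :: "real^'n"
  assumes "trop_smooth \<nu> f" "trop_vertex \<nu> f p"
  shows "unimodular_simplex (max_terms \<nu> f p)"
proof -
  obtain w where w: "max_terms \<nu> f p \<subseteq> max_terms \<nu> f w" "unimodular_simplex (max_terms \<nu> f w)"
    using assms(1) unfolding trop_smooth_def by blast
  have fin: "finite (max_terms \<nu> f p)"
    by (simp add: max_terms_def)
  have "int CARD('n) \<le> int (card (proj_real ` max_terms \<nu> f p)) - 1"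
    using assms(2) aff_dim_le_card[of "proj_real ` max_terms \<nu> f p"] fin by (simp add: trop_vertex_def)
  also have "\<dots> \<le> int (card (max_terms \<nu> f p)) - 1"
    using card_image_le[OF fin, of proj_real] by simp
  finally have "card (max_terms \<nu> f w) \<le> card (max_terms \<nu> f p)"
    using w(2) by (simp add: unimodular_simplex_def)
  then have "max_terms \<nu> f p = max_terms \<nu> f w"
    using w by (intro card_seteq) (simp_all add: unimodular_simplex_def)
  then show ?thesis
    using w(2) by simp
qed

lemma tropical_vertex_exists:
  fixes \<nu> :: "'k::field_char_0 \<Rightarrow> real" and f :: "('n::finite option \<Rightarrow>\<^sub>0 nat) \<Rightarrow>\<^sub>0 'k"
  assumes "alg_closed TYPE('k)" "nonarch_valuation \<nu>" "homogeneous_of_degree f d" "0 < d"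
    and "trop_smooth \<nu> f" "trop_vertex \<nu> f p"
  shows "\<exists>P U D \<delta>. tropical_vertex \<nu> f d P U D \<delta> p"
proof -
  define S where "S = max_terms \<nu> f p"
  have "unimodular_simplex S"
    unfolding S_def using assms by (intro smooth_vertex_simplex)
  then obtain u0 where S: "finite S" "card S = CARD('n) + 1" "u0 \<in> S"
    and basis: "\<And>v :: int^'n. \<exists>a. v = (\<Sum>u\<in>S. a u *s (proj_int u - proj_int u0))"
    unfolding unimodular_simplex_def by blast
  have "S \<subseteq> Poly_Mapping.keys f"
    by (auto simp: S_def max_terms_def)
  obtain U :: "'n option \<Rightarrow> 'n option \<Rightarrow>\<^sub>0 nat" where U: "bij_betw U UNIV S"
    using finite_same_card_bij[of "UNIV :: 'n option set" S] S by auto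
  then have inj: "inj U" and range: "range U = S"
    by (auto simp: bij_betw_def)
  have keys: "U k \<in> Poly_Mapping.keys f" for k
    using range \<open>S \<subseteq> Poly_Mapping.keys f\<close> by blast
  obtain m where m: "u0 = U m"
    using S(3) range by blast
  have "\<exists>D. \<forall>i j. (\<Sum>k\<in>UNIV. D i k * int (Poly_Mapping.lookup (U k) j)) = (if i = j then int d else 0)"
  proof (rule scaled_inverse_of_basis)
    show "(\<Sum>j\<in>UNIV. Poly_Mapping.lookup (U k) j) = d" for k
      using assms(3) keys by (simp add: homogeneous_of_degree_def)
    fix i
    obtain a where a: "(axis i 1 :: int^'n) = (\<Sum>u\<in>S. a u *s (proj_int u - proj_int u0))"
      using basis by blast
    also have "\<dots> = (\<Sum>k\<in>UNIV. a (U k) *s (proj_int (U k) - proj_int (U m)))"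
      unfolding m by (rule sum.reindex_bij_betw[OF U, symmetric])
    finally have "(axis i 1 :: int^'n) $ j = (\<Sum>k\<in>UNIV. a (U k) *s (proj_int (U k) - proj_int (U m))) $ j" for j
      by simp
    then have "(if j = i then 1 else 0) = (\<Sum>k\<in>UNIV. a (U k) * (int (Poly_Mapping.lookup (U k) (Some j))
      - int (Poly_Mapping.lookup (U m) (Some j))))" for j
      by (simp add: axis_def proj_int_def right_diff_distrib)
    then have "\<forall>j. (\<Sum>k\<in>UNIV. a (U k) * (int (Poly_Mapping.lookup (U k) (Some j))
      - int (Poly_Mapping.lookup (U m) (Some j)))) = (if i = j then 1 else 0)"
      by (metis (no_types, lifting))
    then show "\<exists>\<alpha>. \<forall>j. (\<Sum>k\<in>UNIV. \<alpha> k * (int (Poly_Mapping.lookup (U k) (Some j))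
      - int (Poly_Mapping.lookup (U m) (Some j)))) = (if i = j then 1 else 0)"
      by (rule exI[of _ "\<lambda>k. a (U k)"])
  qed
  then obtain D where DU: "\<And>i j. (\<Sum>k\<in>UNIV. D i k * int (Poly_Mapping.lookup (U k) j)) = (if i = j then int d else 0)"
    by blast
  have UD: "(\<Sum>j\<in>UNIV. int (Poly_Mapping.lookup (U k) j) * D j l) = (if k = l then int d else 0)" for k l
    using scaled_inverse_commutes[of "int d" D "\<lambda>k j. int (Poly_Mapping.lookup (U k) j)"] DU assms(4) by simp
  define W where "W = - \<nu> (Poly_Mapping.lookup f u0) + proj_real u0 \<bullet> p"
  \<comment> \<open>The common value \<open>W\<close> of the maximal terms is spread evenly over the
    \<open>d\<close> factors of each monomial, which brings them to valuation 0 at any lift.\<close>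
  define P where "P j = (case j of None \<Rightarrow> 0 | Some i \<Rightarrow> p $ i) - W / real d" for j
  define h where "h u = \<nu> (Poly_Mapping.lookup f u) - (\<Sum>j\<in>UNIV. real (Poly_Mapping.lookup u j) * P j)" for u
  have h: "h u = W - (- \<nu> (Poly_Mapping.lookup f u) + proj_real u \<bullet> p)" if "u \<in> Poly_Mapping.keys f" for u
  proof -
    have "(\<Sum>j\<in>UNIV. real (Poly_Mapping.lookup u j) * P j) =
        proj_real u \<bullet> p - (\<Sum>j\<in>UNIV. real (Poly_Mapping.lookup u j)) * (W / real d)"
      unfolding P_def right_diff_distrib sum_subtractf sum_distrib_right
      by (simp add: sum_UNIV_option inner_vec_def proj_real_def)
    moreover have "(\<Sum>j\<in>UNIV. real (Poly_Mapping.lookup u j)) = real d"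
      using assms(3) that unfolding homogeneous_of_degree_def by (metis of_nat_sum)
    ultimately show ?thesis
      using assms(4) by (simp add: h_def)
  qed
  have max: "u \<in> S \<longleftrightarrow> u \<in> Poly_Mapping.keys f \<and> (\<forall>v\<in>Poly_Mapping.keys f. h u \<le> h v)" for u
  proof -
    have "- \<nu> (Poly_Mapping.lookup f v) + proj_real v \<bullet> p \<le> - \<nu> (Poly_Mapping.lookup f u) + proj_real u \<bullet> p
        \<longleftrightarrow> h u \<le> h v" if "u \<in> Poly_Mapping.keys f" "v \<in> Poly_Mapping.keys f" for v
      unfolding h[OF that(1)] h[OF that(2)] by linarith
    then show ?thesis
      unfolding S_def max_terms_def by blast
  qed
  have u0: "u0 \<in> Poly_Mapping.keys f"
    using S(3) max by blast
  have h0: "h u0 = 0"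
    unfolding h[OF u0] W_def by simp
  have on: "h u = 0" if "u \<in> S" for u
    using that S(3) max u0 h0 by (metis order_antisym)
  have off: "0 < h u" if "u \<in> Poly_Mapping.keys f - S" for u
    using that S(3) max h0 on by (metis DiffE linorder_not_less order_trans)
  \<comment> \<open>The entry 1 covers the case in which all terms are maximal.\<close>
  define \<delta> where "\<delta> = Min (insert 1 (h ` (Poly_Mapping.keys f - S)))"
  have "0 < \<delta>" "\<And>u. u \<in> Poly_Mapping.keys f \<Longrightarrow> u \<notin> S \<Longrightarrow> \<delta> \<le> h u"
    using off by (auto simp: \<delta>_def)
  then have "tropical_vertex \<nu> f d P U D \<delta> p"
    using assms DU UD inj keys on range
    by unfold_locales (auto simp: h_def P_def)
  then show ?thesis
    by blast
qed

theorem theorem1p5: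
  fixes \<nu> :: "'k::field_char_0 \<Rightarrow> real"
    and f :: "('n::finite option \<Rightarrow>\<^sub>0 nat) \<Rightarrow>\<^sub>0 'k"
    and d :: nat and p :: "real^'n"
  assumes "alg_closed TYPE('k)"
    and "nonarch_valuation \<nu>"
    and "irreducible f"
    and "homogeneous_of_degree f d" and "d \<ge> 2"
    and "involves_all_vars f"
    and "trop_smooth \<nu> f"
    and "p \<in> trop_hyp \<nu> f"
    and "trop_vertex \<nu> f p"
  shows "closure {q. trop_tangent \<nu> f p q} =
    (\<Union>J \<in> Jset \<nu> f p. {- p - (\<Sum>i\<in>J. t i *\<^sub>R evec i) | t. \<forall>i\<in>J. t i \<ge> 0})"
proof -
  have "0 < d"
    using assms(5) by simp
  then obtain P U D \<delta> where "tropical_vertex \<nu> f d P U D \<delta> p"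
    using tropical_vertex_exists[OF assms(1,2,4) _ assms(7,9)] by blast
  then interpret tropical_vertex \<nu> f d P U D \<delta> p .
  show ?thesis
    using closure_tangents unfolding tangent_cone_def .
qed

end
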